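(* Every finitely generated acylindrically hyperbolic group $\Gamma$ has infinite girth, i.e. $\operatorname{Gir}(\Gamma)=\infty$.
   Context: Girth: for a finitely generated group $\Gamma$ and a finite generating set $S$, consider words in the formal alphabet $S^{\pm1}$. A word is reduced if no letter is immediately followed by its formal inverse, and cyclically reduced if, in addition, the first and last letters are not formal inverses. $\operatorname{Gir}(\Gamma,S)$ is the smallest length of a nonempty cyclically reduced word representing the identity of $\Gamma$, with $\operatorname{Gir}(\Gamma,S)=\infty$ if no such word exists; $\operatorname{Gir}(\Gamma)=\sup_S\operatorname{Gir}(\Gamma,S)$ over all finite generating sets $S$. An isometric action of $\Gamma$ on a metric space $(X,d)$ is acylindrical if for every $\epsilon>0$ there are $\eta,M>0$ such that for all $x,y\in X$ with $d(x,y)\ge\eta$, the number of $s\in\Gamma$ with $d(x,sx)\le\epsilon$ and $d(y,sy)\le\epsilon$ is at most $M$. A group is acylindrically hyperbolic if it admits a non-elementary acylindrical action on a (Gromov) hyperbolic space; non-elementary has the standard meaning here: the limit set of $\Gamma$ on the Gromov boundary has more than two points. *)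

theory Defs
  imports
    "HOL-Algebra.Generated_Groups"
    "HOL-Algebra.Group_Action"
    "HOL-Library.Extended_Nat"
    "HOL-Analysis.Abstract_Metric_Spaces"
begin

definition finite_generating_set :: "('a, 'b) monoid_scheme \<Rightarrow> 'a set \<Rightarrow> bool" where
  "finite_generating_set G S \<longleftrightarrow> finite S \<and> S \<subseteq> carrier G \<and> generate G S = carrier G"

definition finitely_generated :: "('a, 'b) monoid_scheme \<Rightarrow> bool" where
  "finitely_generated G \<longleftrightarrow> (\<exists>S. finite_generating_set G S)"

text \<open>
  The letter \<open>(s, True)\<close> stands for \<open>s\<close> and \<open>(s, False)\<close> for its formal inverse. In
  particular \<open>(s, False)\<close> differs from \<open>(t, True)\<close> even if \<open>t\<close> is the inverse of \<open>s\<close> in the group.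
\<close>

type_synonym 'a letter = "'a \<times> bool"

definition formal_inverse :: "'a letter \<Rightarrow> 'a letter" where
  "formal_inverse l = (fst l, \<not> snd l)"

definition letter_value :: "('a, 'b) monoid_scheme \<Rightarrow> 'a letter \<Rightarrow> 'a" where
  "letter_value G l = (if snd l then fst l else inv\<^bsub>G\<^esub> (fst l))"

definition word_value :: "('a, 'b) monoid_scheme \<Rightarrow> 'a letter list \<Rightarrow> 'a" where
  "word_value G w = foldr (\<lambda>l a. letter_value G l \<otimes>\<^bsub>G\<^esub> a) w \<one>\<^bsub>G\<^esub>"

definition reduced :: "'a letter list \<Rightarrow> bool" where
  "reduced w \<longleftrightarrow> successively (\<lambda>l l'. l' \<noteq> formal_inverse l) w"

definition cyclically_reduced :: "'a letter list \<Rightarrow> bool" where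
  "cyclically_reduced w \<longleftrightarrow> reduced w \<and> (w \<noteq> [] \<longrightarrow> hd w \<noteq> formal_inverse (last w))"

text \<open>The infimum of the empty set of extended naturals is \<open>\<infinity>\<close>.\<close>

definition girth_wrt :: "('a, 'b) monoid_scheme \<Rightarrow> 'a set \<Rightarrow> enat" where
  "girth_wrt G S =
     Inf {enat (length w) | w. w \<noteq> [] \<and> w \<in> lists (S \<times> UNIV) \<and> cyclically_reduced w \<and>
                               word_value G w = \<one>\<^bsub>G\<^esub>}"

definition girth :: "('a, 'b) monoid_scheme \<Rightarrow> enat" where
  "girth G = Sup {girth_wrt G S | S. finite_generating_set G S}"

context Metric_space
begin

definition gromov_product :: "'a \<Rightarrow> 'a \<Rightarrow> 'a \<Rightarrow> real" where
  "gromov_product p x y = (d p x + d p y - d x y) / 2"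

definition gromov_hyperbolic :: bool where
  "gromov_hyperbolic \<longleftrightarrow>
     (\<exists>\<delta>\<ge>0. \<forall>p\<in>M. \<forall>x\<in>M. \<forall>y\<in>M. \<forall>z\<in>M.
        gromov_product p x z \<ge> min (gromov_product p x y) (gromov_product p y z) - \<delta>)"

text \<open>
  Divergence of the Gromov product does not depend on the base point, since changing the base
  point from \<open>p\<close> to \<open>q\<close> alters the product by at most \<open>d p q\<close>.
\<close>

definition gromov_asymptotic :: "(nat \<Rightarrow> 'a) \<Rightarrow> (nat \<Rightarrow> 'a) \<Rightarrow> bool" where
  "gromov_asymptotic u v \<longleftrightarrow>
     (\<forall>p\<in>M. filterlim (\<lambda>(i, j). gromov_product p (u i) (v j)) at_top
                      (sequentially \<times>\<^sub>F sequentially))"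

definition gromov_sequences :: "(nat \<Rightarrow> 'a) set" where
  "gromov_sequences = {u. range u \<subseteq> M \<and> gromov_asymptotic u u}"

definition gromov_boundary :: "(nat \<Rightarrow> 'a) set set" where
  "gromov_boundary =
     gromov_sequences // {(u, v). u \<in> gromov_sequences \<and> v \<in> gromov_sequences \<and>
                                  gromov_asymptotic u v}"

end

locale isometric_action = Metric_space M d + group_action G M \<phi>
  for M :: "'x set" and d :: "'x \<Rightarrow> 'x \<Rightarrow> real" and G (structure) and \<phi> +
  assumes isometric:
    "\<lbrakk>g \<in> carrier G; x \<in> M; y \<in> M\<rbrakk> \<Longrightarrow> d (\<phi> g x) (\<phi> g y) = d x y"
begin

definition acylindrical :: bool where
  "acylindrical \<longleftrightarrow>
     (\<forall>\<epsilon>>0. \<exists>\<eta>>0. \<exists>N>0. \<forall>x\<in>M. \<forall>y\<in>M. d x y \<ge> \<eta> \<longrightarrow>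
        finite {s \<in> carrier G. d x (\<phi> s x) \<le> \<epsilon> \<and> d y (\<phi> s y) \<le> \<epsilon>} \<and>
        card {s \<in> carrier G. d x (\<phi> s x) \<le> \<epsilon> \<and> d y (\<phi> s y) \<le> \<epsilon>} \<le> (N :: nat))"

text \<open>
  Orbits of different points stay at bounded distance from each other, so in a hyperbolic space
  they all accumulate at the same boundary points.
\<close>

definition limit_set :: "(nat \<Rightarrow> 'x) set set" where
  "limit_set = {\<xi> \<in> gromov_boundary. \<exists>x\<in>M. \<exists>u\<in>\<xi>. range u \<subseteq> orbit G \<phi> x}"

definition non_elementary :: bool where
  "non_elementary \<longleftrightarrow> infinite limit_set \<or> card limit_set > 2"

end

text \<open>
  HOL cannot quantify existentially over types, so the type in which the hyperbolic space lives
  is a parameter. A theorem assuming this predicate for a type variable covers every space.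
\<close>

definition acylindrically_hyperbolic :: "'x itself \<Rightarrow> ('a, 'b) monoid_scheme \<Rightarrow> bool" where
  "acylindrically_hyperbolic _ G \<longleftrightarrow>
     (\<exists>(M :: 'x set) d \<phi>. isometric_action M d G \<phi> \<and>
        Metric_space.gromov_hyperbolic M d \<and>
        isometric_action.acylindrical M d G \<phi> \<and>
        isometric_action.non_elementary M d G \<phi>)"

end

theory Submission
  imports Defs
begin

text \<open>
  Fix a base point \<open>b\<close> of the hyperbolic space and put \<open>len g = d b (g b)\<close>. All the geometry that is
  needed takes place on the orbit of \<open>b\<close>, so it can be expressed by this length function on the
  group and by the four-point inequality for the Gromov products \<open>gp x y\<close> of group elements. Three
  points of the limit set provide arbitrarily long elements \<open>x\<close>, \<open>y\<close>, \<open>z\<close> whose mutual Gromov products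
  stay below a fixed bound (\<open>three_directions\<close>).

  Two long elements with a small Gromov product already give a loxodromic element \<open>h\<close>: one of \<open>x\<close>,
  \<open>y\<close>, \<open>x y\<close> (\<open>exists_loxodromic\<close>). Its powers form a quasi-line. If \<open>s\<close> carries an end of this line
  to an end of this line, then the line and its translate run side by side for ever;
  acylindricity leaves finitely many ways to do so, and the pigeonhole principle produces
  nonzero \<open>p\<close>, \<open>q\<close> with \<open>s h\<^sup>p = h\<^sup>q s\<close> (\<open>commensurating_or_diverging\<close>). Such \<open>s\<close> form a subgroup,
  the commensurator of \<open>h\<close>. It is proper: an element of it maps the quasi-line close to itself, so
  if it were everything then the whole group would lie near one line, which has only two
  directions (\<open>not_all_commensurating\<close>). Hence the group has a finite generating set \<open>S\<close> disjoint
  from the commensurator (\<open>generating_set_avoiding_subgroup\<close>).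

  Let \<open>U\<close> be the set of elements pointing far along the line. Every \<open>s\<close> in \<open>S\<close> and its inverse move \<open>U\<close>
  off itself, while every nonzero power of a suitable \<open>f = h\<^sup>L\<close> moves the complement of \<open>U\<close> into \<open>U\<close>.
  By ping-pong, a product of letters from \<open>S\<close> and their inverses separated by nonzero powers of
  \<open>f\<close> cannot be trivial. Finally number the elements of \<open>S\<close> as \<open>s\<^sub>1, \<dots>, s\<^sub>m\<close> and pass to the
  generating set consisting of \<open>f\<close> and all \<open>f\<^bsup>K i\<^esup> s\<^sub>i f\<^bsup>K i\<^esup>\<close>. In a reduced word of length below \<open>K\<close> in
  these generators the padding between two letters cannot be cancelled, so the word is
  nontrivial (\<open>girth_infinite_if_ping_pong\<close>). As \<open>K\<close> is arbitrary, the girth is infinite. This does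
  not make the group free: \<open>f\<close> is chosen before \<open>K\<close>, and words of length \<open>K\<close> or more may cancel the
  padding.
\<close>

section \<open>Ping-pong and short relations\<close>

context group
begin

lemma word_value_Cons:
  "word_value G (l # w) = letter_value G l \<otimes> word_value G w"
  by (simp add: word_value_def)

lemma word_value_closed:
  assumes "S \<subseteq> carrier G" "w \<in> lists (S \<times> UNIV)"
  shows "word_value G w \<in> carrier G"
  using assms(2)
proof (induction w)
  case Nil
  then show ?case by (simp add: word_value_def)
next
  case (Cons l w)
  then show ?case using assms(1) by (auto simp: word_value_Cons letter_value_def)
qed

lemma reduced_Cons:
  "reduced (l # w) \<longleftrightarrow> reduced w \<and> (w \<noteq> [] \<longrightarrow> hd w \<noteq> formal_inverse l)"
  by (cases w) (auto simp: reduced_def)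

text \<open>
  With exponents \<open>k s\<close> that are distinct and positive, the powers of \<open>f\<close> that meet between two
  consecutive padded letters add up to zero only if the two letters are formally inverse.
\<close>
definition padded :: "'a \<Rightarrow> ('a \<Rightarrow> int) \<Rightarrow> 'a \<Rightarrow> 'a" where
  "padded f k s = f [^] k s \<otimes> s \<otimes> f [^] k s"

lemma padded_closed [simp]:
  "f \<in> carrier G \<Longrightarrow> s \<in> carrier G \<Longrightarrow> padded f k s \<in> carrier G"
  by (simp add: padded_def)

lemma inv_padded:
  assumes "f \<in> carrier G" "s \<in> carrier G"
  shows "inv (padded f k s) = f [^] (- k s) \<otimes> inv s \<otimes> f [^] (- k s)"
  using assms by (simp add: padded_def inv_mult_group m_assoc int_pow_neg)

lemma generate_padded:
  assumes "f \<in> carrier G" "finite_generating_set G S"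
  shows "finite_generating_set G (insert f (padded f k ` S))" (is "finite_generating_set G ?T")
proof -
  have S: "finite S" "S \<subseteq> carrier G" "generate G S = carrier G"
    using assms(2) by (auto simp: finite_generating_set_def)
  have T: "?T \<subseteq> carrier G" using assms(1) S(2) by auto
  interpret H: subgroup "generate G ?T" G using generate_is_subgroup[OF T] .
  have f: "f \<in> generate G ?T" by (auto intro: generate.incl)
  have fp: "f [^] (n::int) \<in> generate G ?T" for n
    using subgroup_int_pow_closed[OF generate_is_subgroup[OF T] f] .
  have "s \<in> generate G ?T" if "s \<in> S" for s
  proof -
    have "padded f k s \<in> generate G ?T" using that by (auto intro: generate.incl)
    then have "f [^] (- k s) \<otimes> padded f k s \<otimes> f [^] (- k s) \<in> generate G ?T"
      using fp by auto
    moreover have "f [^] (- k s) \<otimes> padded f k s \<otimes> f [^] (- k s) = s"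
      using assms(1) S(2) that
      by (simp add: padded_def m_assoc[symmetric] int_pow_neg subset_iff)
         (simp add: m_assoc subset_iff)
    ultimately show ?thesis by simp
  qed
  then have "S \<subseteq> generate G ?T" by blast
  then have "carrier G \<subseteq> generate G ?T"
    using generate_subgroup_incl[OF _ generate_is_subgroup[OF T]] S(3) by metis
  then have "generate G ?T = carrier G" using generate_incl[OF T] by auto
  then show ?thesis using S(1) T by (auto simp: finite_generating_set_def)
qed

text \<open>
  The bookkeeping of the ping-pong argument: a word \<open>w\<close>, applied to the starting point \<open>f\<^bsup>K J\<^esup>\<close>, takes
  the form \<open>f\<^bsup>K c + e\<^esup> v\<close> with \<open>v\<close> outside \<open>U\<close>. Here \<open>K c\<close> is the left padding of the first padded letter
  of \<open>w\<close>, and \<open>e\<close> counts, with sign, the letters \<open>f\<close> that precede it. The starting point behaves like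
  a padded letter whose index \<open>J\<close> differs from all indices in use, hence the clause for the empty
  word.
\<close>
definition leading_exponent ::
  "'a \<Rightarrow> 'a set \<Rightarrow> ('a \<Rightarrow> int) \<Rightarrow> ('a \<Rightarrow> int) \<Rightarrow> int \<Rightarrow> 'a letter list \<Rightarrow> int \<Rightarrow> int \<Rightarrow> bool" where
  "leading_exponent f S k i J w c e \<longleftrightarrow>
     w = [] \<and> c = J \<and> e = 0 \<or>
     w \<noteq> [] \<and> fst (hd w) \<noteq> f \<and> e = 0 \<and>
       (\<exists>s\<in>S. fst (hd w) = padded f k s \<and> c = (if snd (hd w) then i s else - i s)) \<or>
     w \<noteq> [] \<and> fst (hd w) = f \<and> (if snd (hd w) then e > 0 else e < 0)"

text \<open>
  Prepending a letter \<open>f\<close> or its inverse changes \<open>e\<close> by one and never towards zero, because the word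
  is reduced. Prepending a padded letter with signed index \<open>j\<close> makes the exponent of \<open>f\<close> in front of \<open>v\<close>
  equal to \<open>K (j + c) + e\<close>. This is nonzero: if \<open>e \<noteq> 0\<close> then because \<open>\<bar>e\<bar> < K\<close>, and if \<open>e = 0\<close> then
  because \<open>j + c = 0\<close> would mean that the letter meets its formal inverse. So the power of \<open>f\<close> moves
  \<open>v\<close> into \<open>U\<close> and the element of \<open>S\<close> moves it out again.
\<close>
lemma padded_reduced_word:
  fixes i :: "'a \<Rightarrow> int" and K J :: int
  assumes f: "f \<in> carrier G" and S: "S \<subseteq> carrier G" and U1: "\<one> \<notin> U"
    and fU: "\<And>n v. n \<noteq> 0 \<Longrightarrow> v \<in> carrier G - U \<Longrightarrow> f [^] (n::int) \<otimes> v \<in> U"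
    and sU: "\<And>s u. s \<in> S \<Longrightarrow> u \<in> U \<inter> carrier G \<Longrightarrow> s \<otimes> u \<notin> U \<and> inv s \<otimes> u \<notin> U"
    and i: "inj_on i S" "\<And>s. s \<in> S \<Longrightarrow> 0 < i s \<and> i s < J"
    and T: "T = insert f (padded f (\<lambda>s. K * i s) ` S)"
    and w: "w \<in> lists (T \<times> UNIV)" "reduced w" "int (length w) < K"
  shows "\<exists>c e v. word_value G w \<otimes> f [^] (K * J) = f [^] (K * c + e) \<otimes> v \<and>
      v \<in> carrier G - U \<and> \<bar>e\<bar> \<le> int (length w) \<and>
      leading_exponent f S (\<lambda>s. K * i s) i J w c e"
  using w
proof (induction w rule: list.induct)
  case Nil
  show ?case
    by (intro exI[of _ J] exI[of _ 0] exI[of _ \<one>]) (use f U1 in \<open>auto simp: word_value_def leading_exponent_def\<close>)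
next
  case (Cons l w)
  have red: "reduced w" "w \<noteq> [] \<Longrightarrow> hd w \<noteq> formal_inverse l"
    using Cons.prems(2) by (simp_all add: reduced_Cons)
  have w': "w \<in> lists (T \<times> UNIV)" "int (length w) < K" using Cons.prems(1,3) by auto
  obtain c e v where IH: "word_value G w \<otimes> f [^] (K * J) = f [^] (K * c + e) \<otimes> v"
      "v \<in> carrier G - U" "\<bar>e\<bar> \<le> int (length w)"
    and cases: "leading_exponent f S (\<lambda>s. K * i s) i J w c e"
    using Cons.IH[OF w'(1) red(1) w'(2)] by blast
  have TG: "T \<subseteq> carrier G" using f S T by auto
  have wG: "word_value G w \<in> carrier G" using word_value_closed[OF TG] Cons.prems by auto
  obtain x b where l: "l = (x, b)" by (cases l)
  have x: "x \<in> T" using Cons.prems(1) l by auto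
  have lG: "letter_value G l \<in> carrier G" using x TG l by (auto simp: letter_value_def)
  have step: "word_value G (l # w) \<otimes> f [^] (K * J)
      = letter_value G l \<otimes> (f [^] (K * c + e) \<otimes> v)"
    using lG wG f IH(1) by (simp add: word_value_Cons m_assoc)
  have vG: "v \<in> carrier G" using IH(2) by auto
  show ?case
  proof (cases "x = f")
    case True
    define d :: int where "d = (if b then 1 else -1)"
    have "letter_value G l = f [^] d" using l True f
      by (simp add: letter_value_def d_def int_pow_neg)
    then have "word_value G (l # w) \<otimes> f [^] (K * J) = f [^] (d + (K * c + e)) \<otimes> v"
      using step f vG by (simp add: int_pow_mult m_assoc)
    then have 1: "word_value G (l # w) \<otimes> f [^] (K * J) = f [^] (K * c + (e + d)) \<otimes> v"
      by (simp add: algebra_simps)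
    have 2: "if b then e + d > 0 else e + d < 0"
      using cases[unfolded leading_exponent_def] red(2) l True
      by (cases "hd w") (auto simp: d_def formal_inverse_def split: if_splits)
    show ?thesis
      by (intro exI[of _ c] exI[of _ "e + d"] exI[of _ v])
         (use 1 2 IH l True in \<open>auto simp: d_def leading_exponent_def\<close>)
  next
    case False
    then obtain s where s: "s \<in> S" "x = padded f (\<lambda>s. K * i s) s" using x T by auto
    have sG: "s \<in> carrier G" using s S by auto
    define j where "j = (if b then i s else - i s)"
    define g where "g = (if b then s else inv s)"
    have gG: "g \<in> carrier G" using sG by (simp add: g_def)
    have "letter_value G l = f [^] (K * j) \<otimes> g \<otimes> f [^] (K * j)"
      using l s f sG
      by (simp add: letter_value_def j_def g_def inv_padded) (simp add: padded_def)
    then have "word_value G (l # w) \<otimes> f [^] (K * J)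
        = f [^] (K * j) \<otimes> (g \<otimes> (f [^] (K * j + (K * c + e)) \<otimes> v))"
      using step f vG gG by (simp add: int_pow_mult m_assoc)
    moreover have "K * j + (K * c + e) = K * (j + c) + e" by (simp add: algebra_simps)
    ultimately have 1: "word_value G (l # w) \<otimes> f [^] (K * J)
        = f [^] (K * j + 0) \<otimes> (g \<otimes> (f [^] (K * (j + c) + e) \<otimes> v))" by simp
    have K: "K > 0" "\<bar>e\<bar> < K" using Cons.prems(3) IH(3) by auto
    have range: "0 < i s" "i s < J" using i(2) s by auto
    have "K * (j + c) + e \<noteq> 0"
    proof (cases "e = 0")
      case True
      have "j + c \<noteq> 0"
      proof (cases "w = []")
        case True
        then have "c = J" using cases by (auto simp: leading_exponent_def)
        then show ?thesis using range by (auto simp: j_def)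
      next
        case nonempty: False
        then obtain s' where s': "s' \<in> S" "fst (hd w) = padded f (\<lambda>s. K * i s) s'"
            "c = (if snd (hd w) then i s' else - i s')"
          using cases True by (auto simp: leading_exponent_def split: if_splits)
        show ?thesis
        proof
          assume "j + c = 0"
          then have "i s = i s'" "snd (hd w) \<noteq> b"
            using range i(2)[OF s'(1)] s'(3) by (auto simp: j_def split: if_splits)
          then have "hd w = formal_inverse l"
            using inj_onD[OF i(1)] s s' l by (cases "hd w") (auto simp: formal_inverse_def)
          then show False using red(2) nonempty by auto
        qed
      qed
      then show ?thesis using True K by auto
    next
      case False
      have "e = K * (- (j + c))" if "K * (j + c) + e = 0" using that by (simp add: algebra_simps)
      then have "K dvd e" if "K * (j + c) + e = 0" using that by (metis dvd_triv_left)
      then show ?thesis using False K zdvd_imp_le[of K "\<bar>e\<bar>"] by auto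
    qed
    then have "f [^] (K * (j + c) + e) \<otimes> v \<in> U \<inter> carrier G"
      using fU IH(2) f vG by auto
    then have 2: "g \<otimes> (f [^] (K * (j + c) + e) \<otimes> v) \<in> carrier G - U"
      using sU[OF s(1)] gG by (auto simp: g_def)
    show ?thesis
      by (intro exI[of _ j] exI[of _ 0] exI[of _ "g \<otimes> (f [^] (K * (j + c) + e) \<otimes> v)"])
         (use 1 2 l False s in \<open>auto simp: j_def leading_exponent_def\<close>)
  qed
qed

text \<open>
  If a short reduced word \<open>w\<close> were trivial, then \<open>f\<^bsup>K J\<^esup> = f\<^bsup>K c + e\<^esup> v\<close> would make \<open>v\<close> a power of \<open>f\<close>
  outside \<open>U\<close>. Only the zeroth power is outside \<open>U\<close>, so \<open>c = J\<close> and \<open>e = 0\<close>, which happens only for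
  the empty word.
\<close>
lemma girth_infinite_if_ping_pong:
  assumes f: "f \<in> carrier G" and S: "finite_generating_set G S" and U1: "\<one> \<notin> U"
    and fU: "\<And>n v. n \<noteq> 0 \<Longrightarrow> v \<in> carrier G - U \<Longrightarrow> f [^] (n::int) \<otimes> v \<in> U"
    and sU: "\<And>s u. s \<in> S \<Longrightarrow> u \<in> U \<inter> carrier G \<Longrightarrow> s \<otimes> u \<notin> U \<and> inv s \<otimes> u \<notin> U"
  shows "girth G = \<infinity>"
proof -
  have SG: "finite S" "S \<subseteq> carrier G" using S by (auto simp: finite_generating_set_def)
  obtain i0 :: "'a \<Rightarrow> nat" where i0: "inj_on i0 S"
    using finite_imp_inj_to_nat_seg[OF SG(1)] by auto
  \<comment> \<open>Indices start at one: an index zero would leave its letter without padding.\<close>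
  define i :: "'a \<Rightarrow> int" where "i s = int (i0 s) + 1" for s
  \<comment> \<open>The value \<open>J\<close> exceeds all of them, so that no letter can cancel the starting point.\<close>
  define J :: int where "J = Max (insert 0 (i ` S)) + 1"
  have i: "inj_on i S" using i0 by (auto simp: i_def inj_on_def)
  have iJ: "0 < i s \<and> i s < J" if "s \<in> S" for s
  proof -
    have "i s \<le> Max (insert 0 (i ` S))" using SG(1) that by (intro Max_ge) auto
    then show ?thesis by (auto simp: J_def i_def)
  qed
  have fpow: "f [^] (n::int) \<in> U" if "n \<noteq> 0" for n
    using fU[OF that, of \<one>] U1 f by simp
  have large: "girth G \<ge> enat N" for N
  proof -
    define K :: int where "K = int N + 1"
    define T where "T = insert f (padded f (\<lambda>s. K * i s) ` S)"
    have T: "finite_generating_set G T" unfolding T_def using generate_padded[OF f S] .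
    have TG: "T \<subseteq> carrier G" using T by (auto simp: finite_generating_set_def)
    have "enat N \<le> enat (length w)"
      if w: "w \<noteq> []" "w \<in> lists (T \<times> UNIV)" "cyclically_reduced w" "word_value G w = \<one>" for w
    proof (rule ccontr)
      assume "\<not> enat N \<le> enat (length w)"
      then have len: "int (length w) < K" by (simp add: K_def)
      have red: "reduced w" using w(3) by (auto simp: cyclically_reduced_def)
      obtain c e v where eq: "word_value G w \<otimes> f [^] (K * J) = f [^] (K * c + e) \<otimes> v"
          "v \<in> carrier G - U" "\<bar>e\<bar> \<le> int (length w)"
        and cases: "leading_exponent f S (\<lambda>s. K * i s) i J w c e"
        using padded_reduced_word[OF f SG(2) U1 fU sU i iJ T_def w(2) red len] by blast
      have "f [^] (K * J - (K * c + e)) = v"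
      proof -
        have "f [^] (K * c + e) \<otimes> f [^] (K * J - (K * c + e)) = f [^] (K * J)"
          using f by (simp add: int_pow_mult[symmetric])
        also have "\<dots> = f [^] (K * c + e) \<otimes> v" using eq(1) w(4) f by simp
        finally show ?thesis using f eq(2) by simp
      qed
      then have "K * J - (K * c + e) = 0" using fpow eq(2) by (metis DiffD2)
      then have e: "e = K * (J - c)" by (simp add: algebra_simps)
      then have "K dvd e" by simp
      moreover have "\<bar>e\<bar> < K" using eq(3) len by simp
      ultimately have "e = 0" using zdvd_imp_le[of K "\<bar>e\<bar>"] by auto
      then have "c = J" using e len by auto
      then show False using cases w(1) \<open>e = 0\<close> iJ by (force simp: leading_exponent_def split: if_splits)
    qed
    then have "enat N \<le> girth_wrt G T" unfolding girth_wrt_def by (intro Inf_greatest) blast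
    also have "\<dots> \<le> girth G" unfolding girth_def using T by (intro Sup_upper) auto
    finally show ?thesis .
  qed
  then show ?thesis
  proof (cases "girth G")
    case (enat n)
    then show ?thesis using large[of "Suc n"] by simp
  qed simp
qed

end

section \<open>Commensurators of cyclic subgroups\<close>

context group
begin

text \<open>
  The elements that conjugate some nonzero power of \<open>h\<close> to another one. For a loxodromic \<open>h\<close> these
  are the elements that preserve its pair of endpoints at infinity, once the action is
  acylindrical; this algebraic form makes the subgroup property immediate.
\<close>
definition commensurator :: "'a \<Rightarrow> 'a set" where
  "commensurator h =
     {s \<in> carrier G. \<exists>(p::int) (q::int). p \<noteq> 0 \<and> q \<noteq> 0 \<and> s \<otimes> h [^] p = h [^] q \<otimes> s}"

lemma commensurating_powers:
  fixes p q n :: int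
  assumes h: "h \<in> carrier G" and s: "s \<in> carrier G" and eq: "s \<otimes> h [^] p = h [^] q \<otimes> s"
  shows "s \<otimes> h [^] (p * n) = h [^] (q * n) \<otimes> s"
proof -
  have nat: "s \<otimes> h [^] (p * int k) = h [^] (q * int k) \<otimes> s" for k
  proof (induction k)
    case (Suc k)
    have "s \<otimes> h [^] (p * int (Suc k)) = s \<otimes> h [^] p \<otimes> h [^] (p * int k)"
      using h s by (simp add: ring_distribs int_pow_mult m_assoc)
    also have "\<dots> = h [^] q \<otimes> (s \<otimes> h [^] (p * int k))" using h s by (simp add: eq m_assoc)
    also have "\<dots> = h [^] (q * int (Suc k)) \<otimes> s"
      using h s by (simp add: Suc ring_distribs int_pow_mult m_assoc)
    finally show ?case .
  qed (use s in simp)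
  show ?thesis
  proof (cases n rule: int_cases2)
    case (nonpos k)
    let ?a = "h [^] (p * int k)" and ?b = "h [^] (q * int k)"
    have "s \<otimes> inv ?a = inv ?b \<otimes> (?b \<otimes> s) \<otimes> inv ?a"
      using h s by (simp add: m_assoc[symmetric])
    also have "\<dots> = inv ?b \<otimes> s" using h s by (simp add: m_assoc flip: nat)
    finally have "s \<otimes> inv ?a = inv ?b \<otimes> s" .
    then show ?thesis using nonpos h by (simp add: int_pow_neg)
  qed (simp add: nat)
qed

lemma subgroup_commensurator:
  assumes h: "h \<in> carrier G"
  shows "subgroup (commensurator h) G"
proof
  show "commensurator h \<subseteq> carrier G" by (auto simp: commensurator_def)
  show "\<one> \<in> commensurator h"
    using h by (auto simp: commensurator_def intro!: exI[of _ 1])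
  fix x assume "x \<in> commensurator h"
  then obtain p q :: int where x: "x \<in> carrier G" "p \<noteq> 0" "q \<noteq> 0" "x \<otimes> h [^] p = h [^] q \<otimes> x"
    by (auto simp: commensurator_def)
  have "h [^] p \<otimes> inv x = inv x \<otimes> (x \<otimes> h [^] p) \<otimes> inv x"
    using h x(1) by (simp add: m_assoc[symmetric])
  also have "\<dots> = inv x \<otimes> h [^] q" using h x(1) by (simp add: x(4) m_assoc)
  finally have "inv x \<otimes> h [^] q = h [^] p \<otimes> inv x" by simp
  then show "inv x \<in> commensurator h" using x by (auto simp: commensurator_def)
  fix y assume "y \<in> commensurator h"
  then obtain p' q' :: int where y: "y \<in> carrier G" "p' \<noteq> 0" "q' \<noteq> 0" "y \<otimes> h [^] p' = h [^] q' \<otimes> y"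
    by (auto simp: commensurator_def)
  have "x \<otimes> y \<otimes> h [^] (p' * p) = x \<otimes> h [^] (p * q') \<otimes> y"
    using commensurating_powers[OF h y(1,4), of p] h x(1) y(1) by (simp add: m_assoc mult.commute)
  also have "\<dots> = h [^] (q * q') \<otimes> (x \<otimes> y)"
    using commensurating_powers[OF h x(1,4), of q'] h x(1) y(1) by (simp add: m_assoc)
  finally have "x \<otimes> y \<otimes> h [^] (p' * p) = h [^] (q * q') \<otimes> (x \<otimes> y)" .
  moreover have "p' * p \<noteq> 0" "q * q' \<noteq> 0" using x y by auto
  ultimately show "x \<otimes> y \<in> commensurator h" using x(1) y(1) unfolding commensurator_def by blast
qed

text \<open>
  Right multiplication by an element \<open>g\<close> outside \<open>H\<close> moves the generators in \<open>H\<close> out of \<open>H\<close>, and \<open>g\<close>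
  itself is kept as a generator in order to undo this.
\<close>
lemma generating_set_avoiding_subgroup:
  assumes S: "finite_generating_set G S" and H: "subgroup H G" and g: "g \<in> carrier G" "g \<notin> H"
  shows "\<exists>S'. finite_generating_set G S' \<and> S' \<inter> H = {}"
proof -
  have SG: "finite S" "S \<subseteq> carrier G" "generate G S = carrier G"
    using S by (auto simp: finite_generating_set_def)
  define T where "T = insert g ((\<lambda>s. if s \<in> H then s \<otimes> g else s) ` S)"
  have T: "T \<subseteq> carrier G" using SG g by (auto simp: T_def)
  have "s \<in> generate G T" if s: "s \<in> S" for s
  proof (cases "s \<in> H")
    case True
    then have "s \<otimes> g \<in> generate G T" using s by (auto simp: T_def intro!: generate.incl)
    moreover have "inv g \<in> generate G T" by (rule generate.inv) (simp add: T_def)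
    ultimately have "s \<otimes> g \<otimes> inv g \<in> generate G T" by (rule generate.eng)
    then show ?thesis using s SG g by (simp add: m_assoc subset_iff)
  next
    case False
    then show ?thesis using s by (auto simp: T_def intro!: generate.incl)
  qed
  then have "S \<subseteq> generate G T" by blast
  then have "carrier G \<subseteq> generate G T"
    using generate_subgroup_incl[OF _ generate_is_subgroup[OF T]] SG(3) by metis
  then have "finite_generating_set G T"
    using generate_incl[OF T] T SG(1) by (auto simp: finite_generating_set_def T_def)
  moreover have "s \<otimes> g \<notin> H" if "s \<in> H" for s
  proof
    assume "s \<otimes> g \<in> H"
    then have "inv s \<otimes> (s \<otimes> g) \<in> H" using that subgroup.m_closed[OF H] subgroup.m_inv_closed[OF H] by blast
    then show False using g that subgroup.mem_carrier[OF H that] by (simp add: m_assoc[symmetric])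
  qed
  then have "T \<inter> H = {}" using g(2) by (auto simp: T_def)
  ultimately show ?thesis by blast
qed

end

section \<open>Hyperbolic length functions\<close>

text \<open>
  The model is \<open>len g = d b (g b)\<close> for an isometric action on a hyperbolic space. Then
  \<open>len (inv x \<otimes> y)\<close> is the distance between the orbit points \<open>x b\<close> and \<open>y b\<close>, it is invariant under
  left multiplication, and the last axiom is the four-point inequality for Gromov products with
  base point \<open>b\<close>.
\<close>
locale hyperbolic_length = group G for G (structure) +
  fixes len :: "'a \<Rightarrow> real" and \<delta> :: real
  assumes len_one [simp]: "len \<one> = 0"
    and len_inv [simp]: "g \<in> carrier G \<Longrightarrow> len (inv g) = len g"
    and len_mult: "g \<in> carrier G \<Longrightarrow> k \<in> carrier G \<Longrightarrow> len (g \<otimes> k) \<le> len g + len k"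
    and delta_nonneg: "0 \<le> \<delta>"
    and hyperbolic: "x \<in> carrier G \<Longrightarrow> y \<in> carrier G \<Longrightarrow> z \<in> carrier G \<Longrightarrow>
      min ((len x + len y - len (inv x \<otimes> y)) / 2) ((len y + len z - len (inv y \<otimes> z)) / 2) - \<delta>
        \<le> (len x + len z - len (inv x \<otimes> z)) / 2"
begin

definition gp :: "'a \<Rightarrow> 'a \<Rightarrow> real" where
  "gp x y = (len x + len y - len (inv x \<otimes> y)) / 2"

lemma len_nonneg: "g \<in> carrier G \<Longrightarrow> 0 \<le> len g"
  using len_mult[of g "inv g"] by simp

lemma inv_mult_cancel [simp]:
  "x \<in> carrier G \<Longrightarrow> y \<in> carrier G \<Longrightarrow> inv x \<otimes> (x \<otimes> y) = y"
  "x \<in> carrier G \<Longrightarrow> y \<in> carrier G \<Longrightarrow> x \<otimes> (inv x \<otimes> y) = y"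
  by (simp_all add: m_assoc[symmetric])

lemma gp_twice: "2 * gp x y = len x + len y - len (inv x \<otimes> y)"
  by (simp add: gp_def)

lemma gp_hyp:
  "x \<in> carrier G \<Longrightarrow> y \<in> carrier G \<Longrightarrow> z \<in> carrier G \<Longrightarrow> min (gp x y) (gp y z) - \<delta> \<le> gp x z"
  using hyperbolic by (simp add: gp_def)

lemma gp_commute:
  assumes "x \<in> carrier G" "y \<in> carrier G"
  shows "gp x y = gp y x"
  using assms len_inv[of "inv x \<otimes> y"] by (simp add: gp_def inv_mult_group)

lemma gp_self: "x \<in> carrier G \<Longrightarrow> gp x x = len x"
  by (simp add: gp_def)

lemma gp_one: "x \<in> carrier G \<Longrightarrow> gp \<one> x = 0"
  by (simp add: gp_def)

lemma gp_le_len: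
  assumes "x \<in> carrier G" "y \<in> carrier G"
  shows "gp x y \<le> len x"
  using assms len_mult[of x "inv x \<otimes> y"] by (simp add: gp_def)

lemma gp_nonneg:
  assumes "x \<in> carrier G" "y \<in> carrier G"
  shows "0 \<le> gp x y"
  using assms len_mult[of "inv x" y] by (simp add: gp_def)

text \<open>
  The Gromov products of \<open>\<one>\<close> and \<open>x y\<close> seen from \<open>x\<close>, and of \<open>x\<close> and \<open>x y\<close> seen from \<open>\<one>\<close>, add up to the
  distance between \<open>\<one>\<close> and \<open>x\<close>. This is how the base point is changed below.
\<close>
lemma gp_flip:
  assumes "x \<in> carrier G" "y \<in> carrier G"
  shows "gp x (x \<otimes> y) = len x - gp (inv x) y"
  using assms by (simp add: gp_def field_simps)

lemma gp_perturb:
  assumes "x \<in> carrier G" "y \<in> carrier G" "z \<in> carrier G"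
  shows "gp x y \<le> gp x z + len (inv y \<otimes> z)"
proof -
  have "len y \<le> len z + len (inv y \<otimes> z)"
    using assms len_mult[of z "inv z \<otimes> y"] len_inv[of "inv y \<otimes> z"] by (simp add: inv_mult_group)
  moreover have "len (inv x \<otimes> z) \<le> len (inv x \<otimes> y) + len (inv y \<otimes> z)"
    using assms len_mult[of "inv x \<otimes> y" "inv y \<otimes> z"] by (simp add: m_assoc)
  ultimately show ?thesis using gp_twice[of x y] gp_twice[of x z] by linarith
qed

lemma gp_translate:
  assumes "s \<in> carrier G" "x \<in> carrier G" "y \<in> carrier G"
  shows "gp (s \<otimes> x) (s \<otimes> y) \<le> gp x y + len s"
proof -
  have "inv (s \<otimes> x) \<otimes> (s \<otimes> y) = inv x \<otimes> y"
    using assms by (simp add: inv_mult_group m_assoc)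
  then show ?thesis
    using assms len_mult[of s x] len_mult[of s y] gp_twice[of x y] gp_twice[of "s \<otimes> x" "s \<otimes> y"] by simp
qed

text \<open>
  Hyperbolicity is mostly used in the following form: if \<open>x\<close> diverges early from \<open>z\<close>, then also from
  everything that follows \<open>z\<close> for longer.
\<close>
lemma gp_hyp_le:
  assumes "x \<in> carrier G" "y \<in> carrier G" "z \<in> carrier G" "gp x z + \<delta> < gp y z"
  shows "gp x y \<le> gp x z + \<delta>"
  using gp_hyp[of x y z] assms by linarith

lemma gp_hyp_le':
  assumes "x \<in> carrier G" "y \<in> carrier G" "z \<in> carrier G" "gp x z + \<delta> < gp x y"
  shows "gp y z \<le> gp x z + \<delta>"
  using gp_hyp[of x y z] assms by linarith

section \<open>Loxodromic elements\<close>

text \<open>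
  The first condition says that \<open>\<one>\<close> lies within bounded distance of any geodesic from a negative to
  a positive power. By invariance every power lies close to the geodesics between powers on its
  two sides, so the powers of \<open>h\<close> form a quasi-line; the constant \<open>C\<close> measures its thickness. The
  second condition says that this line is properly embedded.
\<close>
definition loxodromic :: "'a \<Rightarrow> real \<Rightarrow> bool" where
  "loxodromic h C \<longleftrightarrow> h \<in> carrier G \<and>
     (\<forall>m\<ge>0. \<forall>n\<ge>0. gp (h [^] (- m :: int)) (h [^] (n :: int)) \<le> C) \<and>
     (\<forall>B. finite {n :: int. len (h [^] n) \<le> B})"

text \<open>
  All positive powers of \<open>h\<close> start in the direction of \<open>h\<close>, and hence diverge from \<open>inv h\<close> as early as \<open>h\<close>
  does. The two statements support each other: the first for one power follows from the second
  for the preceding power by a change of base point, and the second follows from the first by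
  hyperbolicity.
\<close>
lemma gp_forward_powers:
  fixes n :: nat
  assumes h: "h \<in> carrier G" and long: "2 * gp (inv h) h + 3 * \<delta> < len h"
  shows "len h - gp (inv h) h - \<delta> \<le> gp (h [^] Suc n) h"
    and "gp (inv h) (h [^] Suc n) \<le> gp (inv h) h + \<delta>"
proof (induction n)
  case 0
  {
    case 1
    show ?case using h gp_nonneg[of "inv h" h] delta_nonneg by (simp add: gp_self)
  next
    case 2
    show ?case using h delta_nonneg by simp
  }
next
  case (Suc n)
  have flip: "gp (h [^] Suc (Suc n)) h = len h - gp (inv h) (h [^] Suc n)"
    using gp_flip[OF h nat_pow_closed[OF h, of "Suc n"]] h
      gp_commute[of h "h [^] Suc (Suc n)"] nat_pow_Suc2[OF h, of "Suc n"] by simp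
  {
    case 1
    show ?case using Suc.IH(2) flip by simp
  next
    case 2
    have "gp (inv h) h + \<delta> < gp (h [^] Suc (Suc n)) h" using flip Suc.IH(2) long delta_nonneg by linarith
    then show ?case using gp_hyp_le[of "inv h" "h [^] Suc (Suc n)" h] h by simp
  }
qed

text \<open>
  An element whose length exceeds twice its backtracking \<open>gp (inv h) h\<close> by a margin gains a definite
  length \<open>c\<close> with every further power.
\<close>
lemma loxodromic_if_long:
  assumes h: "h \<in> carrier G" and long: "2 * gp (inv h) h + 3 * \<delta> < len h"
  shows "loxodromic h (gp (inv h) h + 2 * \<delta>)"
proof -
  let ?r = "gp (inv h) h"
  have hi: "inv h \<in> carrier G" using h by simp
  have sym: "gp (inv (inv h)) (inv h) = ?r" using h gp_commute[of h "inv h"] by simp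
  have fwd: "len h - ?r - \<delta> \<le> gp (h [^] Suc n) h" "?r + 2 * \<delta> < gp (h [^] Suc n) h" for n :: nat
    using gp_forward_powers(1)[OF h long, of n] long delta_nonneg by linarith+
  have bwd: "gp h (inv h [^] Suc n) \<le> ?r + \<delta>" for n :: nat
    using gp_forward_powers(2)[OF hi, of n] h long sym by simp
  have nat_gp: "gp (inv h [^] m) (h [^] n) \<le> ?r + 2 * \<delta>" for m n :: nat
  proof (cases "m = 0 \<or> n = 0")
    case True
    then have "gp (inv h [^] m) (h [^] n) = 0"
      using h gp_one gp_commute[of "inv h [^] m" \<one>] by auto
    then show ?thesis using gp_nonneg[OF hi h] delta_nonneg by simp
  next
    case False
    then obtain a b where ab: "m = Suc a" "n = Suc b" by (meson not0_implies_Suc)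
    have le: "gp (inv h [^] m) h \<le> ?r + \<delta>"
      using bwd[of a] ab gp_commute[of h "inv h [^] m"] h by simp
    then have "gp (inv h [^] m) h + \<delta> < gp (h [^] n) h" using fwd(2)[of b] ab by simp
    then have "gp (inv h [^] m) (h [^] n) \<le> gp (inv h [^] m) h + \<delta>"
      using gp_hyp_le[of "inv h [^] m" "h [^] n" h] h by simp
    then show ?thesis using le by simp
  qed
  define c where "c = len h - 2 * ?r - 2 * \<delta>"
  have c: "c > 0" using long delta_nonneg by (simp add: c_def)
  have grow: "real n * c \<le> len (h [^] n)" for n :: nat
  proof (induction n)
    case (Suc n)
    show ?case
    proof (cases n)
      case 0
      then show ?thesis using h gp_nonneg[OF hi h] delta_nonneg by (simp add: c_def)
    next
      case (Suc k)
      have "gp (inv h) (h [^] n) \<le> ?r + \<delta>" using gp_forward_powers(2)[OF h long, of k] Suc by simp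
      moreover have "len (h [^] Suc n) = len h + len (h [^] n) - 2 * gp (inv h) (h [^] n)"
        using h nat_pow_Suc2[OF h, of n] gp_twice[of "inv h" "h [^] n"] by simp
      ultimately show ?thesis using Suc.IH by (simp add: c_def algebra_simps)
    qed
  qed (use h in simp)
  have grow_int: "\<bar>real_of_int n\<bar> * c \<le> len (h [^] n)" for n :: int
  proof (cases n rule: int_cases2)
    case (nonneg k)
    have "h [^] n = h [^] k" using nonneg by (simp only: int_pow_int)
    then show ?thesis using grow[of k] nonneg by simp
  next
    case (nonpos k)
    have "h [^] n = inv (h [^] k)" using nonpos h by (simp only: int_pow_neg_int)
    then show ?thesis using grow[of k] nonpos h by simp
  qed
  have "finite {n :: int. len (h [^] n) \<le> B}" for B
  proof (rule finite_subset)
    show "{n :: int. len (h [^] n) \<le> B} \<subseteq> {- \<lceil>B / c\<rceil>..\<lceil>B / c\<rceil>}"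
    proof
      fix n :: int assume "n \<in> {n. len (h [^] n) \<le> B}"
      then have "\<bar>real_of_int n\<bar> * c \<le> B" using grow_int[of n] by simp
      then have "\<bar>real_of_int n\<bar> \<le> B / c" using c by (simp add: pos_le_divide_eq)
      then have "\<bar>n\<bar> \<le> \<lceil>B / c\<rceil>" by linarith
      then show "n \<in> {- \<lceil>B / c\<rceil>..\<lceil>B / c\<rceil>}" by auto
    qed
  qed simp
  moreover have "gp (h [^] (- m)) (h [^] n) \<le> ?r + 2 * \<delta>" if mn: "m \<ge> 0" "n \<ge> 0" for m n :: int
  proof -
    obtain a b where ab: "m = int a" "n = int b"
      using zero_le_imp_eq_int[OF mn(1)] zero_le_imp_eq_int[OF mn(2)] by blast
    have 1: "h [^] (- m) = inv h [^] a" unfolding ab using nat_pow_inv[OF h] int_pow_neg_int[OF h] by metis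
    have 2: "h [^] n = h [^] b" unfolding ab by (rule int_pow_int)
    show ?thesis unfolding 1 2 by (rule nat_gp)
  qed
  ultimately show ?thesis using h by (simp add: loxodromic_def)
qed

text \<open>
  If neither \<open>a\<close> nor \<open>b\<close> is long compared to its backtracking, then \<open>a\<close> and \<open>inv a\<close> share about half of
  their length, and so do \<open>b\<close> and \<open>inv b\<close>. As \<open>a\<close> and \<open>b\<close> diverge early, so do \<open>inv a\<close> and \<open>b\<close> as well as
  \<open>a\<close> and \<open>inv b\<close>. Therefore \<open>a b\<close> starts along \<open>a\<close>, its inverse starts along \<open>inv b\<close>, there is little
  backtracking, and \<open>a b\<close> is almost as long as \<open>a\<close> and \<open>b\<close> together.
\<close>
lemma exists_loxodromic:
  assumes ab: "a \<in> carrier G" "b \<in> carrier G" "len a \<ge> T" "len b \<ge> T" "gp a b \<le> R"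
    and T: "T > 2 * R + 7 * \<delta>"
  shows "\<exists>h C. loxodromic h C"
proof -
  have R: "R \<ge> 0" using gp_nonneg ab by force
  show ?thesis
  proof (cases "2 * gp (inv a) a + 3 * \<delta> < len a \<or> 2 * gp (inv b) b + 3 * \<delta> < len b")
    case True
    then show ?thesis using loxodromic_if_long ab by blast
  next
    case False
    have ba: "gp (inv a) b \<le> R + \<delta>"
      using gp_hyp_le'[of a "inv a" b] False ab T gp_commute[of a "inv a"] delta_nonneg by force
    have ab': "gp a (inv b) \<le> R + \<delta>"
      using gp_hyp_le[of a "inv b" b] False ab T delta_nonneg by force
    let ?g = "a \<otimes> b"
    have g: "?g \<in> carrier G" "inv ?g \<in> carrier G" using ab by auto
    have len: "len ?g \<ge> 2 * T - 2 * R - 2 * \<delta>"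
      using ba ab by (simp add: gp_def)
    have ga: "gp a ?g \<ge> T - R - \<delta>" using gp_flip[of a b] ab ba by simp
    have gb: "gp (inv b) (inv ?g) \<ge> T - R - \<delta>"
      using gp_flip[of "inv b" "inv a"] ab ba gp_commute[of b "inv a"] by (simp add: inv_mult_group)
    have "gp a (inv ?g) \<le> R + 2 * \<delta>"
      using gp_hyp_le[of a "inv ?g" "inv b"] gb ab g ab' T R delta_nonneg
        gp_commute[of "inv b" "inv ?g"] by simp
    then have "gp ?g (inv ?g) \<le> R + 3 * \<delta>"
      using gp_hyp_le'[of a ?g "inv ?g"] ga ab g T R delta_nonneg by simp
    then have "2 * gp (inv ?g) ?g + 3 * \<delta> < len ?g"
      using len T gp_commute[OF g] delta_nonneg by simp
    then show ?thesis using loxodromic_if_long g by blast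
  qed
qed

context
  fixes h C
  assumes lox: "loxodromic h C"
begin

lemma lox_closed [simp]: "h \<in> carrier G"
  using lox by (simp add: loxodromic_def)

lemma lox_gp: "0 \<le> m \<Longrightarrow> 0 \<le> n \<Longrightarrow> gp (h [^] (- m :: int)) (h [^] (n :: int)) \<le> C"
  using lox by (simp add: loxodromic_def)

lemma lox_finite: "finite {n :: int. len (h [^] n) \<le> B}"
  using lox by (simp add: loxodromic_def)

lemma lox_const_nonneg: "0 \<le> C"
  using lox_gp[of 0 0] by (simp add: gp_one)

lemma lox_escape:
  obtains L :: int where "L > 0" "\<And>n. L \<le> \<bar>n\<bar> \<Longrightarrow> B < len (h [^] n)"
proof -
  obtain L where L: "\<And>n. n \<in> {n :: int. len (h [^] n) \<le> B} \<Longrightarrow> \<bar>n\<bar> < L"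
  proof
    fix n assume n: "n \<in> {n :: int. len (h [^] n) \<le> B}"
    have "\<bar>n\<bar> \<le> Max (abs ` {n :: int. len (h [^] n) \<le> B})"
      using n lox_finite by (intro Max_ge) auto
    then show "\<bar>n\<bar> < Max (abs ` {n :: int. len (h [^] n) \<le> B}) + 1" by simp
  qed
  show thesis
  proof (rule that[of "max L 1"])
    show "B < len (h [^] n)" if "max L 1 \<le> \<bar>n\<bar>" for n :: int
      using L[of n] that by (cases "len (h [^] n) \<le> B") auto
  qed simp
qed

lemma lox_infinite_order:
  assumes "h [^] (n :: int) = \<one>"
  shows "n = 0"
proof (rule ccontr)
  assume n: "n \<noteq> 0"
  obtain L :: int where L: "L > 0" "\<And>n. L \<le> \<bar>n\<bar> \<Longrightarrow> 0 < len (h [^] n)"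
    using lox_escape[of 0] by blast
  have "L \<le> \<bar>n * L\<bar>" using n L(1) by (simp add: abs_mult)
  then have "0 < len (h [^] (n * L))" using L(2) by blast
  moreover have "h [^] (n * L) = \<one>" using assms by (simp flip: int_pow_pow)
  ultimately show False by simp
qed

lemma lox_same_side:
  fixes m n :: int
  assumes "0 \<le> m \<and> 0 \<le> n \<or> m \<le> 0 \<and> n \<le> 0"
  shows "min (len (h [^] m)) (len (h [^] n)) - C \<le> gp (h [^] m) (h [^] n)"
proof -
  have le: "len (h [^] m) - C \<le> gp (h [^] m) (h [^] n)"
    if "0 \<le> m \<and> m \<le> n \<or> n \<le> m \<and> m \<le> 0" for m n :: int
  proof -
    have "gp (h [^] (- m)) (h [^] (n - m)) \<le> C"
      using lox_gp[of m "n - m"] lox_gp[of "m - n" "- m"] that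
        gp_commute[of "h [^] (- m)" "h [^] (n - m)"] by auto
    moreover have "gp (h [^] m) (h [^] n) = len (h [^] m) - gp (h [^] (- m)) (h [^] (n - m))"
      using gp_flip[of "h [^] m" "h [^] (n - m)"] by (simp add: int_pow_mult[symmetric] int_pow_neg)
    ultimately show ?thesis by simp
  qed
  show ?thesis using le[of m n] le[of n m] assms gp_commute[of "h [^] m" "h [^] n"] by fastforce
qed

text \<open>
  A translated quasi-line whose segment from \<open>g h\<^sup>a\<close> to \<open>g h\<^sup>b\<close> has a small Gromov product at \<open>\<one>\<close> must
  pass near \<open>\<one>\<close>. Along the segment the points first lie on the side of one end and finally on the
  side of the other. At the place of change the Gromov products with both ends are small, and
  a point close to the geodesic between two ends that diverges from both ends early is short.
\<close>
lemma near_quasi_line: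
  fixes a b :: int
  assumes g: "g \<in> carrier G" and "a \<le> b" and B: "gp (g \<otimes> h [^] a) (g \<otimes> h [^] b) \<le> B"
  shows "\<exists>j::int. len (g \<otimes> h [^] j) \<le> C + 2 * (B + \<delta>) + len h"
proof -
  define y where "y j = g \<otimes> h [^] j" for j :: int
  have y: "y j \<in> carrier G" for j using g by (simp add: y_def)
  have diff: "inv (y i) \<otimes> y j = h [^] (j - i)" for i j
    using g by (simp add: y_def inv_mult_group m_assoc int_pow_neg[symmetric] int_pow_mult[symmetric])
  \<comment> \<open>Every point of the segment diverges early from at least one of the two ends.\<close>
  have small: "gp (y a) (y j) \<le> B + \<delta> \<or> gp (y j) (y b) \<le> B + \<delta>" for j
    using gp_hyp[OF y y y, of a j b] B unfolding y_def by linarith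
  have "\<exists>j. a \<le> j \<and> j \<le> b \<and> gp (y a) (y j) \<le> B + \<delta> + len h \<and> gp (y j) (y b) \<le> B + \<delta> \<or>
            a \<le> j \<and> j \<le> b \<and> gp (y a) (y j) \<le> B + \<delta> \<and> gp (y j) (y b) \<le> B + \<delta> + len h"
  proof -
    define P where "P k \<longleftrightarrow> gp (y a) (y (a + int k)) \<le> B + \<delta>" for k
    show ?thesis
    proof (cases "P 0")
      case True
      then have "gp (y a) (y a) \<le> B + \<delta>" by (simp add: P_def)
      then have "gp (y a) (y a) \<le> B + \<delta> \<and> gp (y a) (y b) \<le> B + \<delta> + len h"
        using B delta_nonneg len_nonneg[of h] by (simp add: y_def)
      then show ?thesis using assms(2) by auto
    next
      case False
      have end': "P (nat (b - a))" using assms(2) B delta_nonneg by (simp add: P_def y_def)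
      define k where "k = (LEAST k. P k)"
      have Pk: "P k" unfolding k_def using end' by (rule LeastI)
      have kle: "k \<le> nat (b - a)" unfolding k_def using end' by (rule Least_le)
      obtain k' where k': "k = Suc k'" using Pk False by (cases k) auto
      have "\<not> P k'" using not_less_Least[of k' P] k' k_def by auto
      then have "gp (y (a + int k')) (y b) \<le> B + \<delta>"
        using small[of "a + int k'"] by (auto simp: P_def)
      moreover have "gp (y b) (y (a + int k)) \<le> gp (y b) (y (a + int k')) + len h"
        using gp_perturb[OF y y y, of b "a + int k" "a + int k'"] k'
        by (simp add: diff int_pow_neg)
      ultimately have "gp (y (a + int k)) (y b) \<le> B + \<delta> + len h"
        using gp_commute[OF y y, of b "a + int k"] gp_commute[OF y y, of b "a + int k'"] by linarith
      then show ?thesis using Pk kle assms(2) unfolding P_def by (intro exI[of _ "a + int k"]) auto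
    qed
  qed
  then obtain j where j: "a \<le> j" "j \<le> b" and
      "gp (y a) (y j) \<le> B + \<delta> + len h \<and> gp (y j) (y b) \<le> B + \<delta> \<or>
       gp (y a) (y j) \<le> B + \<delta> \<and> gp (y j) (y b) \<le> B + \<delta> + len h"
    by blast
  then have sum: "gp (y a) (y j) + gp (y j) (y b) \<le> 2 * (B + \<delta>) + len h" by auto
  have "gp (h [^] (- (j - a))) (h [^] (b - j)) \<le> C" using lox_gp[of "j - a" "b - j"] j by simp
  then have "len (inv (y j) \<otimes> y a) + len (inv (y j) \<otimes> y b) - len (inv (y a) \<otimes> y b) \<le> 2 * C"
    using diff by (simp add: gp_def int_pow_neg[symmetric] int_pow_mult[symmetric])
  moreover have "len (inv (y j) \<otimes> y a) = len (inv (y a) \<otimes> y j)"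
    using len_inv[of "inv (y j) \<otimes> y a"] y by (simp add: inv_mult_group)
  moreover have "gp (y a) (y b) \<ge> 0" using gp_nonneg y by simp
  ultimately have "len (y j) \<le> C + (gp (y a) (y j) + gp (y j) (y b))"
    by (simp add: gp_def field_simps)
  then have "len (y j) \<le> C + 2 * (B + \<delta>) + len h" using sum by linarith
  then show ?thesis unfolding y_def by blast
qed

text \<open>
  If the line of \<open>h\<close> and its translate by \<open>s\<close> stay together far beyond \<open>h\<^sup>t\<close>, then the translate passes
  near \<open>h\<^sup>t\<close>: seen from \<open>h\<^sup>t\<close>, the starting point \<open>s\<close> of the translate is behind and the point \<open>s h\<^sup>m\<close> is
  ahead, so the segment between them has a small Gromov product.
\<close>
lemma fellow_travel:
  assumes s: "s \<in> carrier G" and t: "0 \<le> t \<and> t \<le> n \<or> n \<le> t \<and> t \<le> 0"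
    and far: "len (h [^] (t::int)) + C + \<delta> < gp (h [^] (n::int)) (s \<otimes> h [^] (m::int))"
  shows "\<exists>j::int. len (h [^] (- t) \<otimes> s \<otimes> h [^] j) \<le> C + 2 * (C + \<delta> + len s + \<delta>) + len h"
proof -
  define g where "g = h [^] (- t) \<otimes> s"
  have g: "g \<in> carrier G" using s by (simp add: g_def)
  have "gp (h [^] n) (s \<otimes> h [^] m) \<le> gp (h [^] (n - t)) (g \<otimes> h [^] m) + len (h [^] t)"
  proof -
    have "h [^] t \<otimes> h [^] (n - t) = h [^] n" by (simp flip: int_pow_mult)
    moreover have "h [^] t \<otimes> (g \<otimes> h [^] m) = s \<otimes> h [^] m"
      using s by (simp add: g_def m_assoc int_pow_neg)
    ultimately show ?thesis
      using gp_translate[of "h [^] t" "h [^] (n - t)" "g \<otimes> h [^] m"] g by simp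
  qed
  then have far': "C + \<delta> < gp (g \<otimes> h [^] m) (h [^] (n - t))"
    using far gp_commute[of "g \<otimes> h [^] m" "h [^] (n - t)"] g by simp
  have near: "gp (h [^] (- t)) (h [^] (n - t)) \<le> C"
    using lox_gp[of t "n - t"] lox_gp[of "t - n" "- t"] t
      gp_commute[of "h [^] (- t)" "h [^] (n - t)"] by auto
  have "gp (h [^] (- t)) (g \<otimes> h [^] m) \<le> gp (h [^] (- t)) (h [^] (n - t)) + \<delta>"
    by (rule gp_hyp_le) (use g far' near in auto)
  then have "gp (g \<otimes> h [^] m) (h [^] (- t)) \<le> C + \<delta>"
    using near gp_commute[of "g \<otimes> h [^] m" "h [^] (- t)"] g by simp
  moreover have "inv g \<otimes> h [^] (- t) = inv s"
    using s by (simp add: g_def inv_mult_group m_assoc int_pow_neg)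
  then have "gp (g \<otimes> h [^] m) g \<le> gp (g \<otimes> h [^] m) (h [^] (- t)) + len s"
    using gp_perturb[of "g \<otimes> h [^] m" g "h [^] (- t)"] s g by simp
  ultimately have B: "gp (g \<otimes> h [^] m) (g \<otimes> h [^] (0::int)) \<le> C + \<delta> + len s"
    using g by simp
  show ?thesis
  proof (cases "m \<le> 0")
    case True
    then show ?thesis using near_quasi_line[OF g True B] by (simp add: g_def)
  next
    case False
    have "gp (g \<otimes> h [^] (0::int)) (g \<otimes> h [^] m) \<le> C + \<delta> + len s"
      using B gp_commute[of "g \<otimes> h [^] m" "g \<otimes> h [^] (0::int)"] g by simp
    then show ?thesis using near_quasi_line[OF g, of 0 m "C + \<delta> + len s"] False by (simp add: g_def)
  qed
qed

text \<open>
  Because \<open>s h\<^sup>y = h\<^sup>z s\<close> for exponents \<open>y\<close>, \<open>z\<close> of arbitrarily large modulus and both signs, the line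
  and its translate by \<open>s\<close> have common ends. Far out, the points of the two lines look alike from
  \<open>s\<close>, so \<open>s\<close>, being on the translate, is near the line. The point is that the bound on the distance
  does not depend on \<open>s\<close>.
\<close>
lemma near_if_commensurating:
  assumes s: "s \<in> commensurator h"
  shows "\<exists>j::int. len (inv s \<otimes> h [^] j) \<le> C + 2 * (C + 2 * \<delta> + \<delta>) + len h"
proof -
  obtain p q :: int where sG: "s \<in> carrier G" and p: "p \<noteq> 0" "q \<noteq> 0" "s \<otimes> h [^] p = h [^] q \<otimes> s"
    using s by (auto simp: commensurator_def)
  obtain L :: int where L: "L > 0" "\<And>n. L \<le> \<bar>n\<bar> \<Longrightarrow> C + 2 * \<delta> + len s < len (h [^] n)"
    using lox_escape by blast
  define a b where "a = p * L" and "b = q * L"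
  have conj: "s \<otimes> h [^] a = h [^] b \<otimes> s"
    unfolding a_def b_def using commensurating_powers[OF _ sG p(3)] L(1) by simp
  have conj': "s \<otimes> h [^] (- a) = h [^] (- b) \<otimes> s"
    using commensurating_powers[OF _ sG conj, of "-1"] by simp
  have "L \<le> \<bar>a\<bar>" using p(1) L(1) by (simp add: a_def abs_mult)
  then have long: "C + 2 * \<delta> + len s < len (h [^] a)" "C + 2 * \<delta> + len s < len (h [^] (- a))"
    using L(2)[of a] L(2)[of "- a"] by auto
  have close: "len (h [^] y) - len s \<le> gp (h [^] y) (inv s \<otimes> h [^] z)"
    if "s \<otimes> h [^] y = h [^] z \<otimes> s" for y z :: int
  proof -
    have "h [^] y = inv s \<otimes> h [^] z \<otimes> s"
      using that sG by (metis inv_solve_left int_pow_closed lox_closed m_assoc m_closed inv_closed)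
    then have "inv (h [^] y) \<otimes> (inv s \<otimes> h [^] z) = inv s"
      using sG by (simp add: inv_mult_group m_assoc)
    then show ?thesis
      using gp_perturb[of "h [^] y" "h [^] y" "inv s \<otimes> h [^] z"] sG by (simp add: gp_self)
  qed
  have c1: "gp (h [^] (- a)) (h [^] a) \<le> C"
    using lox_gp[of a a] lox_gp[of "- a" "- a"] gp_commute[of "h [^] (- a)" "h [^] a"]
    by (cases "a \<ge> 0") auto
  have c2: "gp (inv s \<otimes> h [^] (- b)) (h [^] a) \<le> C + \<delta>"
    using gp_hyp_le'[of "h [^] (- a)" "inv s \<otimes> h [^] (- b)" "h [^] a"] close[OF conj'] c1 long sG delta_nonneg
    by simp
  have c3: "gp (inv s \<otimes> h [^] (- b)) (inv s \<otimes> h [^] b) \<le> C + 2 * \<delta>"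
    using gp_hyp_le[of "inv s \<otimes> h [^] (- b)" "inv s \<otimes> h [^] b" "h [^] a"] close[OF conj] c2 long sG
      gp_commute[of "h [^] a" "inv s \<otimes> h [^] b"] by simp
  show ?thesis
  proof (cases "b \<ge> 0")
    case True
    then show ?thesis using near_quasi_line[OF _ _ c3] sG by simp
  next
    case False
    have "gp (inv s \<otimes> h [^] b) (inv s \<otimes> h [^] (- b)) \<le> C + 2 * \<delta>"
      using c3 gp_commute[of "inv s \<otimes> h [^] (- b)" "inv s \<otimes> h [^] b"] sG by simp
    from near_quasi_line[OF _ _ this] show ?thesis using False sG by simp
  qed
qed

text \<open>
  Otherwise all elements would lie within distance \<open>D\<close> of the powers of \<open>h\<close>. Among three long
  elements two would be near powers on the same side of \<open>\<one>\<close>, and those have a large Gromov product.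
\<close>
lemma not_all_commensurating:
  assumes dirs: "\<And>T. \<exists>a\<in>carrier G. \<exists>b\<in>carrier G. \<exists>c\<in>carrier G.
      T \<le> len a \<and> T \<le> len b \<and> T \<le> len c \<and> gp a b \<le> R \<and> gp a c \<le> R \<and> gp b c \<le> R"
  shows "\<exists>g\<in>carrier G. g \<notin> commensurator h"
proof (rule ccontr)
  assume all: "\<not> ?thesis"
  define D where "D = C + 2 * (C + 2 * \<delta> + \<delta>) + len h"
  define T where "T = R + 3 * D + C + 1"
  obtain a b c where abc: "a \<in> carrier G" "b \<in> carrier G" "c \<in> carrier G"
      "T \<le> len a" "T \<le> len b" "T \<le> len c" "gp a b \<le> R" "gp a c \<le> R" "gp b c \<le> R"
    using dirs by blast
  have near: "\<exists>i::int. len (inv x \<otimes> h [^] i) \<le> D" if "x \<in> carrier G" for x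
    using near_if_commensurating all that unfolding D_def by blast
  obtain i j k :: int where ijk: "len (inv a \<otimes> h [^] i) \<le> D" "len (inv b \<otimes> h [^] j) \<le> D"
      "len (inv c \<otimes> h [^] k) \<le> D"
    using near abc(1-3) by meson
  have "\<not> (0 \<le> m \<and> 0 \<le> n \<or> m \<le> 0 \<and> n \<le> 0)"
    if xy: "x \<in> carrier G" "y \<in> carrier G" "T \<le> len x" "T \<le> len y" "gp x y \<le> R"
      "len (inv x \<otimes> h [^] m) \<le> D" "len (inv y \<otimes> h [^] n) \<le> D" for x y and m n :: int
  proof
    assume same: "0 \<le> m \<and> 0 \<le> n \<or> m \<le> 0 \<and> n \<le> 0"
    have close: "len z - D \<le> len (h [^] l) \<and> gp w (h [^] l) \<le> gp w z + D"
      if "z \<in> carrier G" "w \<in> carrier G" "len (inv z \<otimes> h [^] l) \<le> D" for z w and l :: int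
    proof -
      have "len (inv (h [^] l) \<otimes> z) \<le> D"
        using that len_inv[of "inv z \<otimes> h [^] l"] by (simp add: inv_mult_group)
      then show ?thesis
        using that gp_perturb[of w "h [^] l" z] len_mult[of "h [^] l" "inv (h [^] l) \<otimes> z"] by simp
    qed
    have "gp (h [^] m) (h [^] n) \<le> gp (h [^] m) y + D" using close xy by simp
    also have "gp (h [^] m) y = gp y (h [^] m)" using gp_commute xy by simp
    also have "\<dots> \<le> gp y x + D" using close xy by simp
    also have "gp y x = gp x y" using gp_commute xy by simp
    finally have "gp (h [^] m) (h [^] n) \<le> R + 2 * D" using xy(5) by simp
    moreover have "T - D \<le> len (h [^] m)" "T - D \<le> len (h [^] n)"
      using close[of x \<one> m] close[of y \<one> n] xy by auto
    ultimately show False using lox_same_side[OF same] by (simp add: T_def)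
  qed
  from this[OF abc(1,2,4,5,7) ijk(1,2)] this[OF abc(1,3,4,6,8) ijk(1,3)]
    this[OF abc(2,3,5,6,9) ijk(2,3)]
  show False by linarith
qed

end

end

section \<open>Acylindricity\<close>

text \<open>
  The two points required by acylindricity are taken to be \<open>\<one>\<close> and \<open>k\<close>; the two inequalities say that
  \<open>s\<close> moves each of them by at most \<open>\<epsilon>\<close>.
\<close>
locale acylindrical_length = hyperbolic_length +
  assumes acylindrical: "0 < \<epsilon> \<Longrightarrow> \<exists>\<eta>. \<forall>k\<in>carrier G. \<eta> \<le> len k \<longrightarrow>
    finite {s \<in> carrier G. len s \<le> \<epsilon> \<and> len (inv k \<otimes> s \<otimes> k) \<le> \<epsilon>}"
begin

text \<open>
  Each point \<open>h\<^bsup>d i\<^esup>\<close> of the half-line is joined to a point \<open>s h\<^sup>j\<close> of the translate by an element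
  \<open>\<sigma> i\<close> of length at most \<open>D\<close>. Choose a power \<open>k\<close> of \<open>h\<close> that is long enough for acylindricity. The
  increment of \<open>j\<close> corresponding to a shift by \<open>k\<close> takes finitely many values, so it is constant
  for infinitely many \<open>i\<close>. For these \<open>i\<close> the quotient of \<open>\<sigma> i\<close> by one fixed \<open>\<sigma> i0\<close> moves both \<open>\<one>\<close> and \<open>k\<close> by
  a bounded amount, which leaves finitely many possibilities for \<open>\<sigma> i\<close>. Two equal values express
  that \<open>s\<close> conjugates a power of \<open>h\<close> to another one.
\<close>
lemma commensurating_if_near_half_line:
  fixes d :: int
  assumes lox: "loxodromic h C" and s: "s \<in> carrier G" and d: "d \<noteq> 0"
    and near: "\<And>i::nat. \<exists>j::int. len (h [^] (- (d * int i)) \<otimes> s \<otimes> h [^] j) \<le> D"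
  shows "s \<in> commensurator h"
proof -
  have h: "h \<in> carrier G" using lox_closed[OF lox] .
  obtain j :: "nat \<Rightarrow> int" where j: "\<And>i. len (h [^] (- (d * int i)) \<otimes> s \<otimes> h [^] j i) \<le> D"
    using near by metis
  define \<sigma> where "\<sigma> i = h [^] (- (d * int i)) \<otimes> s \<otimes> h [^] j i" for i
  have \<sigma>: "\<sigma> i \<in> carrier G" "len (\<sigma> i) \<le> D" for i
    using j s h by (auto simp: \<sigma>_def)
  have D: "0 \<le> D" using \<sigma>[of 0] len_nonneg by (meson order_trans)
  obtain \<eta> where \<eta>: "\<And>k. k \<in> carrier G \<Longrightarrow> \<eta> \<le> len k \<Longrightarrow>
      finite {s \<in> carrier G. len s \<le> 2 * D + 1 \<and> len (inv k \<otimes> s \<otimes> k) \<le> 2 * D + 1}"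
    using acylindrical[of "2 * D + 1"] D by auto
  obtain L :: int where L: "L > 0" "\<And>n. L \<le> \<bar>n\<bar> \<Longrightarrow> \<eta> < len (h [^] n)"
    using lox_escape[OF lox] by blast
  define P where "P = nat L"
  define k where "k = h [^] (d * L)"
  have k: "k \<in> carrier G" using h by (simp add: k_def)
  have "L \<le> \<bar>d * L\<bar>" using d L(1) by (simp add: abs_mult)
  then have "\<eta> \<le> len k" using L(2)[of "d * L"] by (simp add: k_def)
  then have fin: "finite {s \<in> carrier G. len s \<le> 2 * D + 1 \<and> len (inv k \<otimes> s \<otimes> k) \<le> 2 * D + 1}"
    using \<eta> k by blast
  define \<Delta> where "\<Delta> i = j (i + P) - j i" for i
  have shift: "\<sigma> i \<otimes> h [^] \<Delta> i = k \<otimes> \<sigma> (i + P)" for i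
  proof -
    have "- (d * int i) = d * L + - (d * int (i + P))"
      using L(1) by (simp add: P_def algebra_simps)
    then have "h [^] (- (d * int i)) = k \<otimes> h [^] (- (d * int (i + P)))"
      using int_pow_mult[OF h] unfolding k_def by metis
    moreover have "h [^] j i \<otimes> h [^] \<Delta> i = h [^] j (i + P)"
      using h by (simp add: \<Delta>_def flip: int_pow_mult)
    ultimately show ?thesis using s h k by (simp add: \<sigma>_def m_assoc)
  qed
  have "range \<Delta> \<subseteq> {n. len (h [^] n) \<le> 2 * D + len k}"
  proof
    fix n assume "n \<in> range \<Delta>"
    then obtain i where n: "n = \<Delta> i" by auto
    have "h [^] n = inv (\<sigma> i) \<otimes> (k \<otimes> \<sigma> (i + P))"
      using shift[of i] \<sigma>(1) h k inv_mult_cancel(1)[of "\<sigma> i" "h [^] \<Delta> i"] by (simp add: n)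
    then have "len (h [^] n) \<le> len (\<sigma> i) + (len k + len (\<sigma> (i + P)))"
      using len_mult[of "inv (\<sigma> i)" "k \<otimes> \<sigma> (i + P)"] len_mult[of k "\<sigma> (i + P)"] \<sigma>(1) k by simp
    then show "n \<in> {n. len (h [^] n) \<le> 2 * D + len k}" using \<sigma>(2)[of i] \<sigma>(2)[of "i + P"] by simp
  qed
  then have "finite (range \<Delta>)" using lox_finite[OF lox] finite_subset by blast
  then obtain i0 where i0: "infinite {i. \<Delta> i = \<Delta> i0}"
    using pigeonhole_infinite[of UNIV \<Delta>] by auto
  define I where "I = {i. \<Delta> i = \<Delta> i0}"
  define \<tau> where "\<tau> i = \<sigma> i \<otimes> inv (\<sigma> i0)" for i
  have len2: "len (\<sigma> i \<otimes> inv (\<sigma> i')) \<le> 2 * D + 1" for i i'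
    using len_mult[of "\<sigma> i" "inv (\<sigma> i')"] \<sigma>(1) \<sigma>(2)[of i] \<sigma>(2)[of i'] by simp
  have "\<tau> ` I \<subseteq> {s \<in> carrier G. len s \<le> 2 * D + 1 \<and> len (inv k \<otimes> s \<otimes> k) \<le> 2 * D + 1}"
  proof (rule image_subsetI)
    fix i assume "i \<in> I"
    then have e: "\<Delta> i = \<Delta> i0" by (simp add: I_def)
    have solve: "\<sigma> i = k \<otimes> \<sigma> (i + P) \<otimes> inv (h [^] \<Delta> i)" for i
      using shift[of i] \<sigma>(1) h k by (metis inv_solve_right int_pow_closed m_closed)
    have "inv k \<otimes> \<tau> i \<otimes> k = \<sigma> (i + P) \<otimes> inv (\<sigma> (i0 + P))"
      unfolding \<tau>_def solve[of i] solve[of i0] e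
      using \<sigma>(1) h k by (simp add: inv_mult_group m_assoc)
    then show "\<tau> i \<in> {s \<in> carrier G. len s \<le> 2 * D + 1 \<and> len (inv k \<otimes> s \<otimes> k) \<le> 2 * D + 1}"
      using len2 \<sigma>(1) by (simp add: \<tau>_def)
  qed
  then have "finite (\<tau> ` I)" using fin finite_subset by blast
  then have "\<not> inj_on \<tau> I" using i0 finite_imageD I_def by blast
  then obtain i i' where i: "i \<noteq> i'" "\<tau> i = \<tau> i'" by (auto simp: inj_on_def)
  then have eq: "\<sigma> i = \<sigma> i'" using \<sigma>(1) by (simp add: \<tau>_def)
  define p where "p = j i - j i'"
  define q where "q = d * int i - d * int i'"
  have q: "q \<noteq> 0" using i(1) d by (simp add: q_def)
  have "s \<otimes> h [^] p = h [^] (d * int i) \<otimes> \<sigma> i \<otimes> h [^] (- j i')"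
    using s h by (simp add: \<sigma>_def p_def m_assoc int_pow_neg int_pow_diff)
  also have "\<dots> = h [^] q \<otimes> s"
    unfolding eq using s h
    by (simp add: \<sigma>_def q_def m_assoc int_pow_neg int_pow_diff)
  finally have conj: "s \<otimes> h [^] p = h [^] q \<otimes> s" .
  have "p \<noteq> 0"
  proof
    assume "p = 0"
    then have "h [^] q \<otimes> s = \<one> \<otimes> s" using conj s by simp
    then have "h [^] q = \<one>" using s h by simp
    then show False using lox_infinite_order[OF lox] q by blast
  qed
  then show ?thesis using conj s q by (auto simp: commensurator_def)
qed

text \<open>
  If the products are unbounded, then the translate by \<open>s\<close> follows the line arbitrarily far in the
  positive or in the negative direction. Failure at some index \<open>i1\<close> of the positive half-line
  and at some index \<open>i2\<close> of the negative one is therefore refuted by a single sufficiently large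
  product.
\<close>
lemma commensurating_or_diverging:
  assumes lox: "loxodromic h C" and s: "s \<in> carrier G" "s \<notin> commensurator h"
  shows "\<exists>R. \<forall>(m::int) (n::int). gp (h [^] n) (s \<otimes> h [^] m) \<le> R"
proof (rule ccontr)
  assume unbounded: "\<not> ?thesis"
  have h: "h \<in> carrier G" using lox_closed[OF lox] .
  define D where "D = C + 2 * (C + \<delta> + len s + \<delta>) + len h"
  obtain i1 :: nat where i1: "\<And>j::int. \<not> len (h [^] (- (1 * int i1)) \<otimes> s \<otimes> h [^] j) \<le> D"
    using commensurating_if_near_half_line[OF lox s(1), of 1 D] s(2) by auto
  obtain i2 :: nat where i2: "\<And>j::int. \<not> len (h [^] (- (-1 * int i2)) \<otimes> s \<otimes> h [^] j) \<le> D"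
    using commensurating_if_near_half_line[OF lox s(1), of "-1" D] s(2) by auto
  define M where "M = Max ((\<lambda>k::int. len (h [^] k)) ` {- int i2..int i1})"
  have M: "len (h [^] k) \<le> M" if "- int i2 \<le> k" "k \<le> int i1" for k :: int
    unfolding M_def using that by (intro Max_ge) auto
  obtain m n :: int where mn: "M + C + \<delta> < gp (h [^] n) (s \<otimes> h [^] m)"
    using unbounded by (meson linorder_not_le)
  have "gp (h [^] n) (s \<otimes> h [^] m) \<le> len (h [^] n)" using gp_le_len h s(1) by simp
  then have "M < len (h [^] n)" using mn lox_const_nonneg[OF lox] delta_nonneg by linarith
  then have "int i1 < n \<or> n < - int i2" using M[of n] by fastforce
  then show False
  proof
    assume "int i1 < n"
    moreover have "len (h [^] int i1) + C + \<delta> < gp (h [^] n) (s \<otimes> h [^] m)"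
      using mn M[of "int i1"] by simp
    ultimately show False
      using fellow_travel[OF lox s(1), of "int i1" n m] i1 unfolding D_def by auto
  next
    assume "n < - int i2"
    moreover have "len (h [^] (- int i2)) + C + \<delta> < gp (h [^] n) (s \<otimes> h [^] m)"
      using mn M[of "- int i2"] by simp
    ultimately show False
      using fellow_travel[OF lox s(1), of "- int i2" n m] i2 unfolding D_def by auto
  qed
qed

text \<open>
  The ping-pong set \<open>U\<close> consists of the elements whose Gromov product with some power of \<open>h\<close> exceeds
  \<open>R\<close>, a neighbourhood of the two ends of the quasi-line.
\<close>
theorem girth_infinite:
  assumes fg: "finitely_generated G"
    and dirs: "\<And>T. \<exists>a\<in>carrier G. \<exists>b\<in>carrier G. \<exists>c\<in>carrier G.
      T \<le> len a \<and> T \<le> len b \<and> T \<le> len c \<and> gp a b \<le> R\<^sub>0 \<and> gp a c \<le> R\<^sub>0 \<and> gp b c \<le> R\<^sub>0"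
  shows "girth G = \<infinity>"
proof -
  obtain h C where lox: "loxodromic h C"
    using exists_loxodromic dirs[of "2 * R\<^sub>0 + 7 * \<delta> + 1"]
    by (metis less_add_one)
  have h: "h \<in> carrier G" using lox_closed[OF lox] .
  have E: "subgroup (commensurator h) G" using subgroup_commensurator[OF h] .
  obtain g where g: "g \<in> carrier G" "g \<notin> commensurator h"
    using not_all_commensurating[OF lox dirs] by blast
  obtain S where S: "finite_generating_set G S" "S \<inter> commensurator h = {}"
    using generating_set_avoiding_subgroup[OF _ E g] fg by (auto simp: finitely_generated_def)
  have fin: "finite S" and SG: "S \<subseteq> carrier G" using S(1) by (auto simp: finite_generating_set_def)
  have "\<exists>r. \<forall>(m::int) (n::int). gp (h [^] n) (s \<otimes> h [^] m) \<le> r" if "s \<in> S" for s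
    using commensurating_or_diverging[OF lox] that S(2) SG by blast
  then obtain r where r: "\<And>s m n. s \<in> S \<Longrightarrow> gp (h [^] (n::int)) (s \<otimes> h [^] (m::int)) \<le> r s"
    by metis
  \<comment> \<open>One summand \<open>len s\<close> pays for moving the base point by \<open>s\<close>, the other one for replacing \<open>s\<close>
    by its inverse, and \<open>\<delta>\<close> for one use of hyperbolicity.\<close>
  define R where "R = Max (insert 0 ((\<lambda>s. r s + 2 * len s + \<delta>) ` S))"
  have R: "r s + 2 * len s + \<delta> \<le> R" if "s \<in> S" for s
    unfolding R_def using fin that by (intro Max_ge) auto
  have R0: "0 \<le> R" unfolding R_def using fin by (intro Max_ge) auto
  obtain L :: int where L: "L > 0" "\<And>n. L \<le> \<bar>n\<bar> \<Longrightarrow> 2 * R < len (h [^] n)"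
    using lox_escape[OF lox] by blast
  define U where "U = {g \<in> carrier G. \<exists>n::int. R < gp g (h [^] n)}"
  have sU: "t \<otimes> u \<notin> U"
    if u: "u \<in> U" and t: "t \<in> carrier G"
      and bound: "\<And>(m::int) (n::int). gp (h [^] n) (inv t \<otimes> h [^] m) + len t + \<delta> \<le> R"
    for t u
  proof
    assume "t \<otimes> u \<in> U"
    then obtain m :: int where m: "R < gp (t \<otimes> u) (h [^] m)" by (auto simp: U_def)
    obtain n :: int where n: "R < gp u (h [^] n)" and uG: "u \<in> carrier G" using u by (auto simp: U_def)
    have "gp (t \<otimes> u) (h [^] m) \<le> gp u (inv t \<otimes> h [^] m) + len t"
      using gp_translate[of t u "inv t \<otimes> h [^] m"] t uG h by simp
    then have "R - len t < gp u (inv t \<otimes> h [^] m)" using m by simp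
    moreover have "min (gp (h [^] n) u) (gp u (inv t \<otimes> h [^] m)) - \<delta> \<le> gp (h [^] n) (inv t \<otimes> h [^] m)"
      using gp_hyp t uG h by simp
    ultimately show False
      using n bound[of n m] gp_commute[of u "h [^] n"] uG h len_nonneg[OF t] by simp
  qed
  show ?thesis
  proof (rule girth_infinite_if_ping_pong[OF _ S(1), of "h [^] L" U])
    show "\<one> \<notin> U" using R0 h by (auto simp: U_def gp_one)
    show "(h [^] L) [^] n \<otimes> v \<in> U" if n: "n \<noteq> 0" and v: "v \<in> carrier G - U" for n :: int and v
    proof -
      define x where "x = L * n"
      have x: "(h [^] L) [^] n = h [^] x" using h by (simp add: x_def int_pow_pow)
      have "L \<le> \<bar>x\<bar>" using n L(1) by (simp add: x_def abs_mult)
      then have "2 * R < len (h [^] x)" using L(2) by blast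
      moreover have "gp v (h [^] (- x)) \<le> R" using v by (auto simp: U_def not_less)
      then have "gp (h [^] (- x)) v \<le> R" using gp_commute[of v "h [^] (- x)"] v h by simp
      moreover have "gp (h [^] x) (h [^] x \<otimes> v) = len (h [^] x) - gp (h [^] (- x)) v"
        using gp_flip[of "h [^] x" v] v h by (simp add: int_pow_neg)
      ultimately have "R < gp (h [^] x \<otimes> v) (h [^] x)"
        using gp_commute[of "h [^] x" "h [^] x \<otimes> v"] v h by simp
      then show ?thesis unfolding x U_def using v h by blast
    qed
    show "s \<otimes> u \<notin> U \<and> inv s \<otimes> u \<notin> U" if s: "s \<in> S" and u: "u \<in> U \<inter> carrier G" for s u
    proof
      have sG: "s \<in> carrier G" using s SG by auto
      show "inv s \<otimes> u \<notin> U"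
      proof (rule sU)
        show "gp (h [^] n) (inv (inv s) \<otimes> h [^] m) + len (inv s) + \<delta> \<le> R" for m n :: int
          using r[OF s, of n m] R[OF s] sG len_nonneg[OF sG] by simp
      qed (use u sG in auto)
      have "gp (h [^] n) (inv s \<otimes> h [^] m) \<le> r s + len s" for m n :: int
        using gp_translate[of "inv s" "s \<otimes> h [^] n" "h [^] m"] sG h r[OF s, of m n]
          gp_commute[of "s \<otimes> h [^] n" "h [^] m"] by simp
      then have "gp (h [^] n) (inv s \<otimes> h [^] m) + len s + \<delta> \<le> R" for m n :: int
        using R[OF s] by (smt (verit))
      then show "s \<otimes> u \<notin> U" using sU u sG by simp
    qed
  qed (use h in simp)
qed

end

section \<open>From the action to a length function\<close>

context Metric_space
begin

lemma gromov_product_commute: "gromov_product p x y = gromov_product p y x"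
  by (simp add: gromov_product_def commute)

lemma gromov_product_perturb:
  assumes "p \<in> M" "x \<in> M" "y \<in> M" "x' \<in> M" "y' \<in> M"
  shows "gromov_product p x y \<le> gromov_product p x' y' + d x x' + d y y'"
proof -
  have "d p x \<le> d p x' + d x x'" "d p y \<le> d p y' + d y y'" "d x' y' \<le> d x x' + d x y + d y y'"
    using triangle[of p x' x] triangle[of p y' y] triangle[of x' x y'] triangle[of x y y']
      assms commute[of x x'] commute[of y y'] by auto
  then show ?thesis by (simp add: gromov_product_def field_simps)
qed

lemma gromov_product_base:
  assumes "p \<in> M" "q \<in> M" "x \<in> M" "y \<in> M"
  shows "gromov_product p x y \<le> gromov_product q x y + d p q"
proof -
  have "d p x \<le> d p q + d q x" "d p y \<le> d p q + d q y"
    using triangle[of p q x] triangle[of p q y] assms by auto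
  then show ?thesis by (simp add: gromov_product_def field_simps)
qed

lemma gromov_asymptotic_iff:
  "gromov_asymptotic u v \<longleftrightarrow>
     (\<forall>p\<in>M. \<forall>R. \<exists>N. \<forall>i\<ge>N. \<forall>j\<ge>N. R \<le> gromov_product p (u i) (v j))"
proof -
  have "(\<forall>\<^sub>F x in sequentially \<times>\<^sub>F sequentially. R \<le> (case x of (i, j) \<Rightarrow> gromov_product p (u i) (v j)))
      \<longleftrightarrow> (\<exists>N. \<forall>i\<ge>N. \<forall>j\<ge>N. R \<le> gromov_product p (u i) (v j))" for p R
    unfolding eventually_prod_sequentially prod.case by blast
  then show ?thesis unfolding gromov_asymptotic_def filterlim_at_top by simp
qed

lemma gromov_sequence_diverges:
  assumes "u \<in> gromov_sequences" "p \<in> M"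
  shows "\<exists>N. \<forall>i\<ge>N. \<forall>j\<ge>N. R \<le> gromov_product p (u i) (u j)"
  using assms by (simp add: gromov_sequences_def gromov_asymptotic_iff)

lemma gromov_asymptotic_commute: "gromov_asymptotic u v \<Longrightarrow> gromov_asymptotic v u"
  unfolding gromov_asymptotic_iff using gromov_product_commute by metis

lemma gromov_asymptotic_trans:
  assumes hyp: "gromov_hyperbolic" and M: "range u \<subseteq> M" "range v \<subseteq> M" "range w \<subseteq> M"
    and uv: "gromov_asymptotic u v" and vw: "gromov_asymptotic v w"
  shows "gromov_asymptotic u w"
  unfolding gromov_asymptotic_iff
proof (intro ballI allI)
  fix p R assume p: "p \<in> M"
  obtain \<delta> where \<delta>: "\<And>x y z. x \<in> M \<Longrightarrow> y \<in> M \<Longrightarrow> z \<in> M \<Longrightarrow>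
      min (gromov_product p x y) (gromov_product p y z) - \<delta> \<le> gromov_product p x z"
    using hyp p unfolding gromov_hyperbolic_def by blast
  obtain N1 where N1: "\<And>i j. i \<ge> N1 \<Longrightarrow> j \<ge> N1 \<Longrightarrow> R + \<delta> \<le> gromov_product p (u i) (v j)"
    using uv p unfolding gromov_asymptotic_iff by blast
  obtain N2 where N2: "\<And>i j. i \<ge> N2 \<Longrightarrow> j \<ge> N2 \<Longrightarrow> R + \<delta> \<le> gromov_product p (v i) (w j)"
    using vw p unfolding gromov_asymptotic_iff by blast
  have "R \<le> gromov_product p (u i) (w j)" if "i \<ge> max N1 N2" "j \<ge> max N1 N2" for i j
  proof -
    have "min (gromov_product p (u i) (v i)) (gromov_product p (v i) (w j)) - \<delta>
        \<le> gromov_product p (u i) (w j)"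
      by (rule \<delta>) (use M in auto)
    moreover have "R + \<delta> \<le> gromov_product p (u i) (v i)" "R + \<delta> \<le> gromov_product p (v i) (w j)"
      using N1[of i i] N2[of i j] that by auto
    ultimately show ?thesis by linarith
  qed
  then show "\<exists>N. \<forall>i\<ge>N. \<forall>j\<ge>N. R \<le> gromov_product p (u i) (w j)" by blast
qed

lemma gromov_boundary_equiv:
  assumes "gromov_hyperbolic"
  shows "equiv gromov_sequences
    {(u, v). u \<in> gromov_sequences \<and> v \<in> gromov_sequences \<and> gromov_asymptotic u v}"
proof (rule equivI)
  show "refl_on gromov_sequences
      {(u, v). u \<in> gromov_sequences \<and> v \<in> gromov_sequences \<and> gromov_asymptotic u v}"
    by (auto simp: refl_on_def gromov_sequences_def)
  show "sym {(u, v). u \<in> gromov_sequences \<and> v \<in> gromov_sequences \<and> gromov_asymptotic u v}"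
    by (auto simp: sym_def intro: gromov_asymptotic_commute)
  show "trans {(u, v). u \<in> gromov_sequences \<and> v \<in> gromov_sequences \<and> gromov_asymptotic u v}"
    unfolding trans_def gromov_sequences_def
    using gromov_asymptotic_trans[OF assms] by blast
qed auto

text \<open>
  Each of the sequences eventually agrees with itself to any prescribed depth. One pair of late
  terms with a large Gromov product would therefore make all late pairs have a large product,
  whereas arbitrarily late pairs with a small product exist.
\<close>
lemma gromov_product_bounded_if_not_asymptotic:
  assumes hyp: "gromov_hyperbolic" and u: "u \<in> gromov_sequences" and v: "v \<in> gromov_sequences"
    and not: "\<not> gromov_asymptotic u v" and p: "p \<in> M"
  shows "\<exists>R N. \<forall>i\<ge>N. \<forall>j\<ge>N. gromov_product p (u i) (v j) \<le> R"
proof -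
  obtain \<delta> where \<delta>0: "0 \<le> \<delta>" and \<delta>: "\<And>x y z. x \<in> M \<Longrightarrow> y \<in> M \<Longrightarrow> z \<in> M \<Longrightarrow>
      min (gromov_product p x y) (gromov_product p y z) - \<delta> \<le> gromov_product p x z"
    using hyp p unfolding gromov_hyperbolic_def by blast
  have uM: "u i \<in> M" and vM: "v i \<in> M" for i using u v by (auto simp: gromov_sequences_def)
  obtain q R where q: "q \<in> M" and R: "\<And>N. \<exists>i\<ge>N. \<exists>j\<ge>N. gromov_product q (u i) (v j) < R"
    using not unfolding gromov_asymptotic_iff by (meson not_le)
  define S where "S = R + d p q"
  obtain N1 where N1: "\<And>i j. i \<ge> N1 \<Longrightarrow> j \<ge> N1 \<Longrightarrow> S + 2 * \<delta> \<le> gromov_product p (u i) (u j)"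
    using gromov_sequence_diverges[OF u p] by blast
  obtain N2 where N2: "\<And>i j. i \<ge> N2 \<Longrightarrow> j \<ge> N2 \<Longrightarrow> S + 2 * \<delta> \<le> gromov_product p (v i) (v j)"
    using gromov_sequence_diverges[OF v p] by blast
  obtain i' j' where ij': "i' \<ge> max N1 N2" "j' \<ge> max N1 N2" "gromov_product q (u i') (v j') < R"
    using R by blast
  have small: "gromov_product p (u i') (v j') < S"
    using gromov_product_base[OF p q uM vM, of i' j'] ij'(3) by (simp add: S_def)
  have "gromov_product p (u i) (v j) \<le> S + 2 * \<delta>" if ij: "i \<ge> max N1 N2" "j \<ge> max N1 N2" for i j
  proof (rule ccontr)
    assume "\<not> gromov_product p (u i) (v j) \<le> S + 2 * \<delta>"
    then have "S + \<delta> \<le> gromov_product p (u i') (v j)"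
      using \<delta>[OF uM uM vM, of i' i j] N1[of i' i] ij ij' by auto
    then have "S \<le> gromov_product p (u i') (v j')"
      using \<delta>[OF uM vM vM, of i' j j'] N2[of j j'] ij ij' \<delta>0 by auto
    then show False using small by simp
  qed
  then show ?thesis by blast
qed

end

context isometric_action
begin

sublocale G: group G
  using group_hom by (rule group_hom.axioms(1))

lemma action_closed: "g \<in> carrier G \<Longrightarrow> x \<in> M \<Longrightarrow> \<phi> g x \<in> M"
  using element_image by blast

lemma dist_orbit:
  assumes "g \<in> carrier G" "k \<in> carrier G" "x \<in> M" "y \<in> M"
  shows "d (\<phi> g x) (\<phi> k y) = d x (\<phi> (inv g \<otimes> k) y)"
proof -
  have "\<phi> (inv g) (\<phi> g x) = x"
    using assms composition_rule[of x "inv g" g] id_eq_one by (metis G.inv_closed G.l_inv restrict_apply')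
  moreover have "\<phi> (inv g) (\<phi> k y) = \<phi> (inv g \<otimes> k) y"
    using assms composition_rule[of y "inv g" k] by simp
  ultimately show ?thesis
    using isometric[of "inv g" "\<phi> g x" "\<phi> k y"] assms action_closed by simp
qed

lemma hyperbolic_length_orbit:
  assumes hyp: "gromov_hyperbolic" and b: "b \<in> M"
  shows "\<exists>\<delta>. hyperbolic_length G (\<lambda>g. d b (\<phi> g b)) \<delta>"
proof -
  obtain \<delta> where \<delta>0: "0 \<le> \<delta>" and \<delta>: "\<And>x y z. x \<in> M \<Longrightarrow> y \<in> M \<Longrightarrow> z \<in> M \<Longrightarrow>
      min (gromov_product b x y) (gromov_product b y z) - \<delta> \<le> gromov_product b x z"
    using hyp b unfolding gromov_hyperbolic_def by blast
  have "hyperbolic_length G (\<lambda>g. d b (\<phi> g b)) \<delta>"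
  proof
    have "\<phi> \<one> b = b" using id_eq_one b by (metis restrict_apply')
    then show "d b (\<phi> \<one> b) = 0" using b by simp
    show "d b (\<phi> (inv g) b) = d b (\<phi> g b)" if g: "g \<in> carrier G" for g
      using dist_orbit[of g \<one> b b] G.one_closed g b \<open>\<phi> \<one> b = b\<close> by (simp add: commute)
    show "d b (\<phi> (g \<otimes> k) b) \<le> d b (\<phi> g b) + d b (\<phi> k b)"
      if "g \<in> carrier G" "k \<in> carrier G" for g k
      using that triangle[of b "\<phi> g b" "\<phi> (g \<otimes> k) b"] dist_orbit[of g "g \<otimes> k" b b] b action_closed
      by (simp add: G.m_assoc[symmetric])
    show "min ((d b (\<phi> x b) + d b (\<phi> y b) - d b (\<phi> (inv x \<otimes> y) b)) / 2)
              ((d b (\<phi> y b) + d b (\<phi> z b) - d b (\<phi> (inv y \<otimes> z) b)) / 2) - \<delta>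
          \<le> (d b (\<phi> x b) + d b (\<phi> z b) - d b (\<phi> (inv x \<otimes> z) b)) / 2"
      if "x \<in> carrier G" "y \<in> carrier G" "z \<in> carrier G" for x y z
      using \<delta>[of "\<phi> x b" "\<phi> y b" "\<phi> z b"] that b action_closed
      by (simp add: gromov_product_def dist_orbit)
  qed (rule \<delta>0)
  then show ?thesis by blast
qed

lemma limit_point_representative:
  assumes "\<xi> \<in> limit_set" and b: "b \<in> M"
  obtains u g K where "u \<in> \<xi>" "u \<in> gromov_sequences"
    "\<And>n. g n \<in> carrier G" "\<And>n. d (u n) (\<phi> (g n) b) \<le> K"
proof -
  obtain x u where u: "\<xi> \<in> gromov_boundary" "x \<in> M" "u \<in> \<xi>" "range u \<subseteq> orbit G \<phi> x"
    using assms(1) by (auto simp: limit_set_def)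
  have "\<exists>g\<in>carrier G. u n = \<phi> g x" for n using u(4) by (force simp: orbit_def)
  then obtain g where g: "\<And>n. g n \<in> carrier G" "\<And>n. u n = \<phi> (g n) x" by metis
  show thesis
  proof
    show "u \<in> \<xi>" by fact
    show "u \<in> gromov_sequences" using u(1,3) by (auto simp: gromov_boundary_def quotient_def)
    show "g n \<in> carrier G" for n by (rule g)
    show "d (u n) (\<phi> (g n) b) \<le> d x b" for n using g isometric u(2) b by simp
  qed
qed

text \<open>
  Three distinct limit points are represented by orbit sequences, which may be moved to the orbit
  of the base point at bounded cost. Terms with a common large index then satisfy all the
  inequalities, with a bound \<open>R\<close> that does not depend on \<open>T\<close>.
\<close>
lemma three_directions:
  assumes hyp: "gromov_hyperbolic" and non: "non_elementary" and b: "b \<in> M"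
  defines "gp \<equiv> \<lambda>g k. gromov_product b (\<phi> g b) (\<phi> k b)"
  obtains R where "\<And>T. \<exists>x\<in>carrier G. \<exists>y\<in>carrier G. \<exists>z\<in>carrier G.
    T \<le> d b (\<phi> x b) \<and> T \<le> d b (\<phi> y b) \<and> T \<le> d b (\<phi> z b) \<and>
    gp x y \<le> R \<and> gp x z \<le> R \<and> gp y z \<le> R"
proof -
  obtain A where "A \<subseteq> limit_set" "card A = 3"
  proof (cases "finite limit_set")
    case True
    then have "3 \<le> card limit_set" using non by (auto simp: non_elementary_def)
    then show thesis using that obtain_subset_with_card_n by metis
  next
    case False
    then show thesis using that infinite_arbitrarily_large by metis
  qed
  then obtain \<xi> \<eta> \<zeta> where lim: "\<xi> \<in> limit_set" "\<eta> \<in> limit_set" "\<zeta> \<in> limit_set"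
    and ne: "\<xi> \<noteq> \<eta>" "\<xi> \<noteq> \<zeta>" "\<eta> \<noteq> \<zeta>"
    by (auto simp: card_3_iff)
  have pair: "\<exists>R N. \<forall>n\<ge>N. gp (g n) (g' n) \<le> R"
    if "\<alpha> \<in> limit_set" "\<beta> \<in> limit_set" "\<alpha> \<noteq> \<beta>"
      and u: "u \<in> \<alpha>" "u \<in> gromov_sequences" "\<And>n. g n \<in> carrier G" "\<And>n. d (u n) (\<phi> (g n) b) \<le> K"
      and v: "v \<in> \<beta>" "v \<in> gromov_sequences" "\<And>n. g' n \<in> carrier G" "\<And>n. d (v n) (\<phi> (g' n) b) \<le> K'"
    for \<alpha> \<beta> u v g g' K K'
  proof -
    let ?r = "{(u, v). u \<in> gromov_sequences \<and> v \<in> gromov_sequences \<and> gromov_asymptotic u v}"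
    have "\<alpha> \<in> gromov_sequences // ?r" "\<beta> \<in> gromov_sequences // ?r"
      using that(1,2) by (auto simp: limit_set_def gromov_boundary_def)
    then have "(u, v) \<notin> ?r"
      using quotient_eq_iff[OF gromov_boundary_equiv[OF hyp]] u(1) v(1) that(3) by blast
    then obtain R N where RN: "\<And>i j. i \<ge> N \<Longrightarrow> j \<ge> N \<Longrightarrow> gromov_product b (u i) (v j) \<le> R"
      using gromov_product_bounded_if_not_asymptotic[OF hyp u(2) v(2) _ b] u(2) v(2) by blast
    have "gp (g n) (g' n) \<le> R + K + K'" if "n \<ge> N" for n
    proof -
      have "u n \<in> M" "v n \<in> M" using u(2) v(2) by (auto simp: gromov_sequences_def)
      then have "gp (g n) (g' n) \<le> gromov_product b (u n) (v n) + d (\<phi> (g n) b) (u n) + d (\<phi> (g' n) b) (v n)"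
        unfolding gp_def using b u(3) v(3) action_closed by (intro gromov_product_perturb) auto
      then show ?thesis
        using RN[of n n] that u(4)[of n] v(4)[of n] commute[of "u n"] commute[of "v n"] by simp
    qed
    then show ?thesis by blast
  qed
  have long: "\<exists>N. \<forall>n\<ge>N. T \<le> d b (\<phi> (g n) b)"
    if u: "u \<in> gromov_sequences" "\<And>n. g n \<in> carrier G" "\<And>n. d (u n) (\<phi> (g n) b) \<le> K" for T u g K
  proof -
    obtain N where N: "\<And>i j. i \<ge> N \<Longrightarrow> j \<ge> N \<Longrightarrow> T + K \<le> gromov_product b (u i) (u j)"
      using gromov_sequence_diverges[OF u(1) b] by blast
    have "T \<le> d b (\<phi> (g n) b)" if "n \<ge> N" for n
    proof -
      have un: "u n \<in> M" using u(1) by (auto simp: gromov_sequences_def)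
      have "T + K \<le> d b (u n)" using N[OF that that] un by (simp add: gromov_product_def)
      also have "\<dots> \<le> d b (\<phi> (g n) b) + d (\<phi> (g n) b) (u n)"
        using triangle b un action_closed u(2) by simp
      finally show ?thesis using u(3)[of n] commute[of "u n"] by simp
    qed
    then show ?thesis by blast
  qed
  obtain u1 g1 K1 where 1: "u1 \<in> \<xi>" "u1 \<in> gromov_sequences" "\<And>n. g1 n \<in> carrier G"
      "\<And>n. d (u1 n) (\<phi> (g1 n) b) \<le> K1"
    using limit_point_representative[OF lim(1) b] by blast
  obtain u2 g2 K2 where 2: "u2 \<in> \<eta>" "u2 \<in> gromov_sequences" "\<And>n. g2 n \<in> carrier G"
      "\<And>n. d (u2 n) (\<phi> (g2 n) b) \<le> K2"
    using limit_point_representative[OF lim(2) b] by blast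
  obtain u3 g3 K3 where 3: "u3 \<in> \<zeta>" "u3 \<in> gromov_sequences" "\<And>n. g3 n \<in> carrier G"
      "\<And>n. d (u3 n) (\<phi> (g3 n) b) \<le> K3"
    using limit_point_representative[OF lim(3) b] by blast
  obtain R12 N12 where R12: "\<And>n. n \<ge> N12 \<Longrightarrow> gp (g1 n) (g2 n) \<le> R12"
    using pair[OF lim(1,2) ne(1) 1 2] by blast
  obtain R13 N13 where R13: "\<And>n. n \<ge> N13 \<Longrightarrow> gp (g1 n) (g3 n) \<le> R13"
    using pair[OF lim(1,3) ne(2) 1 3] by blast
  obtain R23 N23 where R23: "\<And>n. n \<ge> N23 \<Longrightarrow> gp (g2 n) (g3 n) \<le> R23"
    using pair[OF lim(2,3) ne(3) 2 3] by blast
  show thesis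
  proof (rule that)
    fix T
    obtain N1 where N1: "\<And>n. n \<ge> N1 \<Longrightarrow> T \<le> d b (\<phi> (g1 n) b)" using long[OF 1(2-4)] by blast
    obtain N2 where N2: "\<And>n. n \<ge> N2 \<Longrightarrow> T \<le> d b (\<phi> (g2 n) b)" using long[OF 2(2-4)] by blast
    obtain N3 where N3: "\<And>n. n \<ge> N3 \<Longrightarrow> T \<le> d b (\<phi> (g3 n) b)" using long[OF 3(2-4)] by blast
    define n where "n = N1 + N2 + N3 + N12 + N13 + N23"
    have "gp (g1 n) (g2 n) \<le> max R12 (max R13 R23)" "gp (g1 n) (g3 n) \<le> max R12 (max R13 R23)"
      "gp (g2 n) (g3 n) \<le> max R12 (max R13 R23)"
      using R12[of n] R13[of n] R23[of n] by (auto simp: n_def)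
    moreover have "T \<le> d b (\<phi> (g1 n) b)" "T \<le> d b (\<phi> (g2 n) b)" "T \<le> d b (\<phi> (g3 n) b)"
      using N1 N2 N3 by (auto simp: n_def)
    ultimately show "\<exists>x\<in>carrier G. \<exists>y\<in>carrier G. \<exists>z\<in>carrier G.
        T \<le> d b (\<phi> x b) \<and> T \<le> d b (\<phi> y b) \<and> T \<le> d b (\<phi> z b) \<and>
        gp x y \<le> max R12 (max R13 R23) \<and> gp x z \<le> max R12 (max R13 R23) \<and>
        gp y z \<le> max R12 (max R13 R23)"
      using 1(3) 2(3) 3(3) by blast
  qed
qed

lemma acylindrical_length_orbit:
  assumes hyp: "gromov_hyperbolic" and acyl: "acylindrical" and b: "b \<in> M"
  shows "\<exists>\<delta>. acylindrical_length G (\<lambda>g. d b (\<phi> g b)) \<delta>"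
proof -
  obtain \<delta> where "hyperbolic_length G (\<lambda>g. d b (\<phi> g b)) \<delta>"
    using hyperbolic_length_orbit[OF hyp b] by blast
  then interpret hyperbolic_length G "\<lambda>g. d b (\<phi> g b)" \<delta> .
  have "acylindrical_length G (\<lambda>g. d b (\<phi> g b)) \<delta>"
  proof
    fix \<epsilon> :: real assume "0 < \<epsilon>"
    then obtain \<eta> N where \<eta>: "\<And>x y. x \<in> M \<Longrightarrow> y \<in> M \<Longrightarrow> \<eta> \<le> d x y \<Longrightarrow>
        finite {s \<in> carrier G. d x (\<phi> s x) \<le> \<epsilon> \<and> d y (\<phi> s y) \<le> \<epsilon>} \<and>
        card {s \<in> carrier G. d x (\<phi> s x) \<le> \<epsilon> \<and> d y (\<phi> s y) \<le> \<epsilon>} \<le> (N :: nat)"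
      using acyl unfolding acylindrical_def by blast
    have "finite {s \<in> carrier G. d b (\<phi> s b) \<le> \<epsilon> \<and> d b (\<phi> (inv k \<otimes> s \<otimes> k) b) \<le> \<epsilon>}"
      if k: "k \<in> carrier G" "\<eta> \<le> d b (\<phi> k b)" for k
    proof -
      have "d (\<phi> k b) (\<phi> s (\<phi> k b)) = d b (\<phi> (inv k \<otimes> s \<otimes> k) b)" if "s \<in> carrier G" for s
        using that k(1) b dist_orbit[of k "s \<otimes> k" b b] composition_rule[of b s k]
        by (simp add: G.m_assoc)
      then have "{s \<in> carrier G. d b (\<phi> s b) \<le> \<epsilon> \<and> d b (\<phi> (inv k \<otimes> s \<otimes> k) b) \<le> \<epsilon>}
          = {s \<in> carrier G. d b (\<phi> s b) \<le> \<epsilon> \<and> d (\<phi> k b) (\<phi> s (\<phi> k b)) \<le> \<epsilon>}"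
        by auto
      then show ?thesis using \<eta>[of b "\<phi> k b"] b k action_closed by simp
    qed
    then show "\<exists>\<eta>. \<forall>k\<in>carrier G. \<eta> \<le> d b (\<phi> k b) \<longrightarrow>
        finite {s \<in> carrier G. d b (\<phi> s b) \<le> \<epsilon> \<and> d b (\<phi> (inv k \<otimes> s \<otimes> k) b) \<le> \<epsilon>}"
      by blast
  qed
  then show ?thesis by blast
qed

lemma girth_infinite_if_acylindrical:
  assumes hyp: "gromov_hyperbolic" and acyl: "acylindrical" and non: "non_elementary"
    and fg: "finitely_generated G"
  shows "girth G = \<infinity>"
proof -
  have "limit_set \<noteq> {}" using non by (auto simp: non_elementary_def)
  then obtain b where b: "b \<in> M" by (auto simp: limit_set_def)
  obtain \<delta> where "acylindrical_length G (\<lambda>g. d b (\<phi> g b)) \<delta>"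
    using acylindrical_length_orbit[OF hyp acyl b] by blast
  then interpret acylindrical_length G "\<lambda>g. d b (\<phi> g b)" \<delta> .
  have gp: "gromov_product b (\<phi> x b) (\<phi> y b) = gp x y" if "x \<in> carrier G" "y \<in> carrier G" for x y
    using that b by (simp add: gp_def gromov_product_def dist_orbit)
  obtain R where "\<And>T. \<exists>x\<in>carrier G. \<exists>y\<in>carrier G. \<exists>z\<in>carrier G.
      T \<le> d b (\<phi> x b) \<and> T \<le> d b (\<phi> y b) \<and> T \<le> d b (\<phi> z b) \<and>
      gromov_product b (\<phi> x b) (\<phi> y b) \<le> R \<and> gromov_product b (\<phi> x b) (\<phi> z b) \<le> R \<and>
      gromov_product b (\<phi> y b) (\<phi> z b) \<le> R"
    using three_directions[OF hyp non b] by blast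
  then have "\<And>T. \<exists>x\<in>carrier G. \<exists>y\<in>carrier G. \<exists>z\<in>carrier G.
      T \<le> d b (\<phi> x b) \<and> T \<le> d b (\<phi> y b) \<and> T \<le> d b (\<phi> z b) \<and>
      gp x y \<le> R \<and> gp x z \<le> R \<and> gp y z \<le> R"
    using gp by (metis (no_types, lifting))
  then show ?thesis by (rule girth_infinite[OF fg])
qed

end

theorem corollary2:
  fixes \<Gamma> :: "('a, 'b) monoid_scheme"
  assumes "group \<Gamma>"
    and "finitely_generated \<Gamma>"
    and "acylindrically_hyperbolic TYPE('x) \<Gamma>"
  shows "girth \<Gamma> = \<infinity>"
proof -
  obtain M :: "'x set" and d \<phi> where action: "isometric_action M d \<Gamma> \<phi>"
    and rest: "Metric_space.gromov_hyperbolic M d" "isometric_action.acylindrical M d \<Gamma> \<phi>"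
      "isometric_action.non_elementary M d \<Gamma> \<phi>"
    using assms(3) unfolding acylindrically_hyperbolic_def by blast
  show ?thesis using isometric_action.girth_infinite_if_acylindrical[OF action rest assms(2)] .
qed

end
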